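(* Let $a,b\in\mathbb{C}$ with $\Re(a)<1$ and $\Re(b)<1$. Then $$\sum_{j=0}^\infty\sum_{k=1}^\infty \frac{(a)_j\,(b)_k}{(j+k+1)!}\,\zeta(a+j)\,\zeta(b+k) = B(1-a,1-b)\,\zeta(a+b-1).$$
   Context: $\zeta$ is the Riemann zeta function (analytically continued), $(a)_j=a(a+1)\cdots(a+j-1)$ is the Pochhammer symbol with $(a)_0=1$ (in particular $(0)_0=1$), and $B(x,y)=\Gamma(x)\Gamma(y)/\Gamma(x+y)$ is the beta function. When $a=-m$ with $m=0,1,2,\ldots$, the product $(a)_j\,\zeta(a+j)$ is understood by its limiting value: for $j=m+1$ it equals $(-1)^m m!$, and for $j\ge m+2$ it equals $0$; likewise for $(b)_k\,\zeta(b+k)$ when $b$ is a non-positive integer. *)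

theory Defs
  imports "HOL-Complex_Analysis.Complex_Analysis"
begin

text \<open>
  The Riemann zeta function, as the analytic continuation to the punctured plane of its
  Dirichlet series on \<open>Re s > 1\<close>. Prescribing the value \<open>0\<close> at the pole \<open>s = 1\<close> is an
  arbitrary choice which makes the description unique as a total function.
\<close>

definition zeta :: "complex \<Rightarrow> complex" where
  "zeta = (THE f. f holomorphic_on (- {1}) \<and>
                  (\<forall>s. Re s > 1 \<longrightarrow> f s = (\<Sum>n. of_nat (Suc n) powr (- s))) \<and>
                  f 1 = 0)"

text \<open>
  The product \<open>(a)\<^sub>j \<zeta>(a + j)\<close>, with its limiting value \<open>(-1)\<^sup>m m!\<close> when \<open>a = -m\<close> and
  \<open>j = m + 1\<close>, where \<open>\<zeta>\<close> is evaluated at its pole. For \<open>a = -m\<close> and \<open>j \<ge> m + 2\<close> the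
  limiting value \<open>0\<close> is the ordinary product, since then \<open>(a)\<^sub>j = 0\<close> and \<open>a + j \<noteq> 1\<close>.
\<close>

definition pochhammer_zeta :: "complex \<Rightarrow> nat \<Rightarrow> complex" where
  "pochhammer_zeta a j =
     (if \<exists>m::nat. a = - of_nat m \<and> j = m + 1
      then (- 1) ^ (j - 1) * fact (j - 1)
      else pochhammer a j * zeta (a + of_nat j))"

end

theory Submission
  imports Defs "HOL-Real_Asymp.Real_Asymp"
begin

text \<open>
  Let \<open>H\<^sub>a(x) = \<Sum>\<^sub>j (a)\<^sub>j \<zeta>(a + j) x\<^sup>j / j!\<close>, the Taylor series of the Hurwitz zeta function
  \<open>\<zeta>(a, 1 - x)\<close>. Since \<open>\<integral> x\<^sup>j (1 - x)\<^sup>k dx = j! k! / (j + k + 1)!\<close> over \<open>[0, 1]\<close>, the double sum over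
  all \<open>j, k \<ge> 0\<close> is \<open>\<integral> H\<^sub>a(x) H\<^sub>b(1 - x) dx\<close>, and the column \<open>k = 0\<close> contributes
  \<open>\<zeta>(b) \<integral> H\<^sub>a = 0\<close>.

  The integral is evaluated after damping. Let \<open>F\<^sub>a(y) = \<Sum>\<^sub>n (n + y)\<^sup>-\<^sup>a exp (- e (n + y))\<close>, the
  periodization of \<open>t\<^sup>-\<^sup>a exp (- e t)\<close> on \<open>t > 0\<close>. Periodization turns convolution on the half line
  into convolution on the circle, so
  \<open>\<integral> F\<^sub>a(1 - x) F\<^sub>b(x) dx = B(1 - a, 1 - b) \<Sum>\<^sub>n n\<^sup>1\<^sup>-\<^sup>a\<^sup>-\<^sup>b exp (- e n)\<close>, and \<open>F\<^sub>a\<close> has mean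
  \<open>\<Gamma>(1 - a) e\<^sup>a\<^sup>-\<^sup>1\<close>. Subtracting the means removes exactly the divergent terms, and as \<open>e \<rightarrow> 0\<close> the
  difference \<open>F\<^sub>a(1 - x) - \<Gamma>(1 - a) e\<^sup>a\<^sup>-\<^sup>1\<close> tends to \<open>H\<^sub>a(x)\<close>.

  Both the continuation of \<open>\<zeta>\<close> and the limit \<open>\<Sum>\<^sub>n n\<^sup>-\<^sup>s exp (- e n) - \<Gamma>(1 - s) e\<^sup>s\<^sup>-\<^sup>1 \<rightarrow> \<zeta>(s)\<close> come from
  expanding \<open>\<integral> t\<^sup>-\<^sup>s exp (- e t) dt\<close> over \<open>t > 1/2\<close> around the integers: this expresses the value at
  \<open>s\<close> by the values at \<open>s + 1, s + 2, \<dots>\<close>, so one can descend strip by strip from \<open>Re s > 1\<close>.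
\<close>

section \<open>Dominated convergence and integrals over unit cells\<close>

lemma LIMSEQ_suminf_dominated:
  fixes f :: "nat \<Rightarrow> nat \<Rightarrow> 'a :: {real_normed_algebra, banach}"
  assumes "\<And>k. (\<lambda>n. f k n) \<longlonglongrightarrow> g k" "\<And>k n. norm (f k n) \<le> M k" "summable M"
  shows "(\<lambda>n. \<Sum>k. f k n) \<longlonglongrightarrow> (\<Sum>k. g k)"
  using tannerys_theorem[of f g sequentially M] assms by (auto simp: case_prod_unfold)

text \<open>The product majorant makes the double family absolutely summable. All partial sums over
  j are bounded by the sum \<open>S n\<close> of the norms, so dominated convergence for series
  performs the swap.\<close>

lemma sums_swap_dominated:
  fixes h :: "nat \<Rightarrow> nat \<Rightarrow> complex"
  assumes f: "summable f" and g: "summable g" and h: "\<And>j n. norm (h j n) \<le> f j * g n"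
  shows "(\<lambda>j. \<Sum>n. h j n) sums (\<Sum>n. \<Sum>j. h j n)"
proof -
  have summ: "summable (h j)" for j
    by (rule summable_comparison_test'[where g="\<lambda>n. f j * g n"]) (use g h in auto)
  have absf: "summable (\<lambda>j. norm (h j n))" for n
    by (rule summable_comparison_test'[where g="\<lambda>j. f j * g n"]) (use f h in \<open>auto intro: summable_mult2\<close>)
  define S where "S n = (\<Sum>j. norm (h j n))" for n
  have S_le: "S n \<le> (\<Sum>j. f j) * g n" for n
    unfolding S_def suminf_mult2[OF f]
    by (intro suminf_le absf h summable_mult2 f)
  have S_ge: "norm (\<Sum>j<N. h j n) \<le> S n" for N n
    unfolding S_def
    by (rule order_trans[OF norm_sum], rule sum_le_suminf) (use absf in auto)
  have S0: "S n \<ge> 0" for n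
    using S_ge[of n 0] by simp
  have sS: "summable S"
    by (rule summable_comparison_test'[where g="\<lambda>n. (\<Sum>j. f j) * g n"])
       (use g S_le S0 in \<open>auto intro: summable_mult\<close>)
  have "(\<lambda>N. \<Sum>n. (\<Sum>j<N. h j n)) \<longlonglongrightarrow> (\<Sum>n. \<Sum>j. h j n)"
    by (rule LIMSEQ_suminf_dominated[where M=S])
       (use sS S_ge summable_LIMSEQ[OF summable_norm_cancel[OF absf]] in auto)
  also have "(\<lambda>N. \<Sum>n. (\<Sum>j<N. h j n)) = (\<lambda>N. \<Sum>j<N. \<Sum>n. h j n)"
    by (intro ext suminf_sum summ)
  finally show ?thesis unfolding sums_def .
qed

lemma set_integrable_const_interval:
  fixes c :: "'a :: {banach, second_countable_topology}" and a b :: real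
  shows "set_integrable lborel {a<..<b} (\<lambda>_. c)"
  unfolding set_integrable_def
  by (intro integrable_real_indicator integrable_scaleR_left)
     (auto simp: emeasure_bounded_finite [unfolded infinity_ennreal_def])

lemma set_integral_LIMSEQ_dominated:
  fixes f :: "nat \<Rightarrow> real \<Rightarrow> complex"
  assumes [measurable]: "A \<in> sets lborel"
    and meas: "\<And>j. set_borel_measurable lborel A (f j)"
    and lim: "\<And>x. x \<in> A \<Longrightarrow> (\<lambda>j. f j x) \<longlonglongrightarrow> F x"
    and bound: "\<And>x j. x \<in> A \<Longrightarrow> norm (f j x) \<le> w x"
    and w: "set_integrable lborel A w"
  shows "set_integrable lborel A F"
    and "(\<lambda>j. LINT x:A|lborel. f j x) \<longlonglongrightarrow> (LINT x:A|lborel. F x)"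
proof -
  note m = meas[unfolded set_borel_measurable_def]
  have l: "AE x in lborel. (\<lambda>i. indicat_real A x *\<^sub>R f i x) \<longlonglongrightarrow> indicat_real A x *\<^sub>R F x"
    using lim by (auto simp: indicator_def intro!: AE_I2)
  have b: "AE x in lborel. norm (indicat_real A x *\<^sub>R f i x) \<le> indicat_real A x *\<^sub>R w x" for i
    using bound by (auto simp: indicator_def intro!: AE_I2)
  have F: "(\<lambda>x. indicat_real A x *\<^sub>R F x) \<in> borel_measurable lborel"
    by (rule borel_measurable_LIMSEQ_metric[OF m]) (use lim in \<open>auto simp: indicator_def\<close>)
  show "set_integrable lborel A F"
    unfolding set_integrable_def
    by (rule integrable_dominated_convergence[OF F m w[unfolded set_integrable_def] l b])
  show "(\<lambda>j. LINT x:A|lborel. f j x) \<longlonglongrightarrow> (LINT x:A|lborel. F x)"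
    unfolding set_lebesgue_integral_def
    by (rule integral_dominated_convergence[OF F m w[unfolded set_integrable_def] l b])
qed

text \<open>Bounding all partial sums of norms by one integrable w serves twice: it makes each term
  integrable and it dominates the partial sums of the series.\<close>

lemma set_integral_sums_dominated:
  fixes f :: "nat \<Rightarrow> real \<Rightarrow> complex"
  assumes A [measurable]: "A \<in> sets lborel"
    and meas: "\<And>j. set_borel_measurable lborel A (f j)"
    and lim: "\<And>x. x \<in> A \<Longrightarrow> (\<lambda>j. f j x) sums F x"
    and bound: "\<And>x N. x \<in> A \<Longrightarrow> (\<Sum>j<N. norm (f j x)) \<le> w x"
    and w: "set_integrable lborel A w"
  shows "set_integrable lborel A F"
    and "(\<lambda>j. LINT x:A|lborel. f j x) sums (LINT x:A|lborel. F x)"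
proof -
  have fi: "set_integrable lborel A (f j)" for j
  proof (rule set_integrable_bound[OF w meas], rule AE_I2, intro impI)
    fix x assume x: "x \<in> A"
    have "norm (f j x) \<le> (\<Sum>j<Suc j. norm (f j x))"
      by (rule member_le_sum) auto
    thus "norm (f j x) \<le> norm (w x)" using bound[OF x, of "Suc j"] by simp
  qed
  have m: "set_borel_measurable lborel A (\<lambda>x. \<Sum>j<N. f j x)" for N
    using meas unfolding set_borel_measurable_def scaleR_sum_right
    by (intro borel_measurable_sum) auto
  have b: "norm (\<Sum>j<N. f j x) \<le> w x" if "x \<in> A" for x N
    using bound[OF that, of N] norm_sum[of "\<lambda>j. f j x" "{..<N}"] by linarith
  note * = set_integral_LIMSEQ_dominated[where f="\<lambda>N x. \<Sum>j<N. f j x", OF A m lim[unfolded sums_def] b w]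
  show "set_integrable lborel A F" by (rule *)
  have "(LINT x:A|lborel. \<Sum>j<N. f j x) = (\<Sum>j<N. LINT x:A|lborel. f j x)" for N
    using fi unfolding set_lebesgue_integral_def set_integrable_def scaleR_sum_right
    by (subst Bochner_Integration.integral_sum) auto
  with * show "(\<lambda>j. LINT x:A|lborel. f j x) sums (LINT x:A|lborel. F x)"
    by (simp add: sums_def)
qed

section \<open>Change of variables and decomposition into unit cells\<close>

lemma set_integral_shift:
  fixes f :: "real \<Rightarrow> 'a :: {banach, second_countable_topology}"
  shows "set_integrable lborel {a<..<b} (\<lambda>x. f (t + x)) \<longleftrightarrow> set_integrable lborel {t+a<..<t+b} f"
    and "(LINT x:{a<..<b}|lborel. f (t + x)) = (LINT x:{t+a<..<t+b}|lborel. f x)"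
proof -
  have *: "(\<lambda>x. indicat_real {a<..<b} x *\<^sub>R f (t + x)) =
        (\<lambda>x. indicat_real {t+a<..<t+b} (t + 1 * x) *\<^sub>R f (t + 1 * x))"
    by (auto simp: indicator_def)
  show "set_integrable lborel {a<..<b} (\<lambda>x. f (t + x)) \<longleftrightarrow> set_integrable lborel {t+a<..<t+b} f"
    unfolding set_integrable_def * by (subst lborel_integrable_real_affine_iff) auto
  show "(LINT x:{a<..<b}|lborel. f (t + x)) = (LINT x:{t+a<..<t+b}|lborel. f x)"
    unfolding set_lebesgue_integral_def *
    by (subst (2) lborel_integral_real_affine[of 1 _ t]) auto
qed

lemma set_integral_reflect:
  fixes f :: "real \<Rightarrow> 'a :: {banach, second_countable_topology}"
  shows "set_integrable lborel {0<..<1} (\<lambda>x. f (1 - x)) \<longleftrightarrow> set_integrable lborel {0<..<1} f"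
    and "(LINT x:{0<..<1}|lborel. f (1 - x)) = (LINT x:{0<..<1}|lborel. f x)"
proof -
  have *: "(\<lambda>x. indicat_real {0<..<1} x *\<^sub>R f (1 - x)) =
        (\<lambda>x. indicat_real {0<..<1} (1 + (-1) * x) *\<^sub>R f (1 + (-1) * x))"
    by (auto simp: indicator_def)
  show "set_integrable lborel {0<..<1} (\<lambda>x. f (1 - x)) \<longleftrightarrow> set_integrable lborel {0<..<1} f"
    unfolding set_integrable_def * by (subst lborel_integrable_real_affine_iff) auto
  show "(LINT x:{0<..<1}|lborel. f (1 - x)) = (LINT x:{0<..<1}|lborel. f x)"
    unfolding set_lebesgue_integral_def *
    by (subst (2) lborel_integral_real_affine[of "-1" _ 1]) auto
qed

text \<open>The half-open cells \<open>{n + c <.. n + c + 1}\<close> partition the half line, so the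
  integrals over the first N cells converge to the whole. The open cell of the statement differs by
  a single point.\<close>

lemma set_integral_unit_cells:
  fixes f :: "real \<Rightarrow> complex"
  assumes f: "set_integrable lborel {c<..} f"
  shows "(\<lambda>n. LINT x:{c<..<c+1}|lborel. f (real n + x)) sums (LINT x:{c<..}|lborel. f x)"
proof -
  let ?A = "\<lambda>n::nat. {real n + c<..real n + (c + 1)}"
  have U: "(\<Union>n. ?A n) = {c<..}"
  proof (intro equalityI subsetI)
    fix x assume "x \<in> {c<..}"
    hence x: "x - c > 0" by simp
    \<comment> \<open>Cells are open on the left and closed on the right, hence the ceiling minus
      one instead of the floor.\<close>
    define n where "n = nat (\<lceil>x - c\<rceil> - 1)"
    have "real n = of_int \<lceil>x - c\<rceil> - 1" using x unfolding n_def by (simp add: of_nat_nat)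
    moreover have "of_int \<lceil>x - c\<rceil> - 1 < x - c" "x - c \<le> of_int \<lceil>x - c\<rceil>"
      using ceiling_correct[of "x - c"] by auto
    ultimately have "x \<in> ?A n" unfolding greaterThanAtMost_iff by linarith
    thus "x \<in> (\<Union>n. ?A n)" by blast
  qed auto
  have disj: "?A i \<inter> ?A j = {}" if "i \<noteq> j" for i j
  proof (rule ccontr)
    assume "?A i \<inter> ?A j \<noteq> {}"
    then obtain x where "x \<in> ?A i" "x \<in> ?A j" by blast
    hence "real i < real j + 1" "real j < real i + 1" by auto
    hence "i < j + 1" "j < i + 1" by linarith+
    thus False using that by simp
  qed
  have int: "set_integrable lborel (\<Union>n. ?A n) f" using f U by simp
  let ?B = "\<lambda>N. \<Union>n<N. ?A n"
  have "(\<lambda>N. LINT x:?B N|lborel. f x) \<longlonglongrightarrow> (LINT x:(\<Union>N. ?B N)|lborel. f x)"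
  proof (rule set_integral_cont_up)
    show "incseq ?B" by (intro monoI UN_mono) auto
    have "(\<Union>N. ?B N) = (\<Union>n. ?A n)" by blast
    thus "set_integrable lborel (\<Union>N. ?B N) f" using int by simp
  qed auto
  also have "(\<Union>N. ?B N) = {c<..}" unfolding U[symmetric] by blast
  also have "(\<lambda>N. LINT x:?B N|lborel. f x) = (\<lambda>N. \<Sum>n<N. LINT x:?A n|lborel. f x)"
  proof
    fix N show "(LINT x:?B N|lborel. f x) = (\<Sum>n<N. LINT x:?A n|lborel. f x)"
      by (rule set_integral_finite_Union)
         (use disj in \<open>auto simp: disjoint_family_on_def intro!: set_integrable_subset[OF f]\<close>)
  qed
  finally have lim: "(\<lambda>n. LINT x:?A n|lborel. f x) sums (LINT x:{c<..}|lborel. f x)"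
    unfolding sums_def .
  have "(LINT x:?A n|lborel. f x) = (LINT x:{c<..<c+1}|lborel. f (real n + x))" for n
  proof -
    have "(LINT x:?A n|lborel. f x) = (LINT x:{real n + c<..<real n + (c+1)}|lborel. f x)"
      unfolding set_lebesgue_integral_def
      by (rule integral_discrete_difference[where X="{real n + (c + 1)}"])
         (auto simp: indicator_def)
    thus ?thesis by (simp add: set_integral_shift)
  qed
  with lim show ?thesis by simp
qed

section \<open>Damped Hurwitz sums\<close>

definition kern :: "real \<Rightarrow> complex \<Rightarrow> real \<Rightarrow> complex" where
  "kern e s t = of_real t powr (- s) * of_real (exp (- (e * t)))"

text \<open>For \<open>e = 0\<close> and Re s > 1 this is the Hurwitz zeta function zeta(s, x).
  Since n starts at 0, the Dirichlet series is \<open>hsum 0 s 1\<close>.\<close>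

definition hsum :: "real \<Rightarrow> complex \<Rightarrow> real \<Rightarrow> complex" where
  "hsum e s x = (\<Sum>n. kern e s (real n + x))"

text \<open>The cases in which \<open>hsum e s x\<close> converges absolutely for \<open>x > 0\<close>.\<close>

definition damp_ok :: "real \<Rightarrow> complex \<Rightarrow> bool" where
  "damp_ok e s \<longleftrightarrow> e > 0 \<or> (e = 0 \<and> Re s > 1)"

lemma norm_kern:
  assumes "t > 0"
  shows "norm (kern e s t) = t powr (- Re s) * exp (- (e * t))"
  using assms by (simp add: kern_def norm_mult norm_powr_real_powr)

lemma summable_powr_exp:
  fixes c x e :: real
  assumes "e > 0"
  shows "summable (\<lambda>n. (real n + x) powr c * exp (- (e * (real n + x))))"
proof (rule summable_comparison_test_bigo)
  show "summable (\<lambda>n. norm (1 / real n ^ 2))"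
    using inverse_power_summable[of 2, where 'a=real] by (simp add: field_simps)
  show "(\<lambda>n. (real n + x) powr c * exp (- (e * (real n + x)))) \<in> O(\<lambda>n. 1 / real n ^ 2)"
    using assms by real_asymp
qed

lemma summable_norm_kern:
  assumes x: "x > 0" and ok: "damp_ok e s"
  shows "summable (\<lambda>n. norm (kern e s (real n + x)))"
proof (cases "e > 0")
  case True
  show ?thesis
    using summable_powr_exp[OF True] x by (simp add: norm_kern)
next
  case False
  with ok have e: "e = 0" and s: "Re s > 1" by (auto simp: damp_ok_def)
  have "summable (\<lambda>n. (real n + x) powr - Re s * exp (- (e * (real n + x))))"
  proof (rule summable_comparison_test_bigo)
    show "summable (\<lambda>n. norm (real n powr (- Re s)))"
      using s by (simp add: summable_real_powr_iff)
    show "(\<lambda>n. (real n + x) powr - Re s * exp (- (e * (real n + x)))) \<in> O(\<lambda>n. real n powr - Re s)"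
      unfolding e by real_asymp
  qed
  thus ?thesis using x by (simp add: norm_kern)
qed

lemma damp_ok_add: "damp_ok e s \<Longrightarrow> damp_ok e (s + of_nat j)"
  by (auto simp: damp_ok_def)

lemma norm_kern_add_nat_le:
  "norm (kern e (s + of_nat j) (real n + 1)) \<le> norm (kern e s (real n + 1))"
  by (auto simp: norm_kern intro!: mult_right_mono powr_mono)

lemma norm_hsum_add_nat_le:
  assumes ok: "damp_ok e s"
  shows "norm (hsum e (s + of_nat j) 1) \<le> (\<Sum>n. norm (kern e s (real n + 1)))"
proof -
  have "norm (hsum e (s + of_nat j) 1) \<le> (\<Sum>n. norm (kern e (s + of_nat j) (real n + 1)))"
    unfolding hsum_def
    by (intro summable_norm summable_norm_kern damp_ok_add ok) auto
  also have "\<dots> \<le> (\<Sum>n. norm (kern e s (real n + 1)))"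
    by (intro suminf_le norm_kern_add_nat_le summable_norm_kern damp_ok_add ok) auto
  finally show ?thesis .
qed

section \<open>Taylor expansion of the damped Hurwitz sum\<close>

text \<open>Up to sign these are the terms of the binomial series of (1 + x)^(-s). Convergence at a
  point of larger modulus y < 1 gives absolute convergence at x.\<close>

lemma pochhammer_power_series:
  fixes s :: complex and x :: real
  assumes "\<bar>x\<bar> < 1"
  shows "summable (\<lambda>j. norm (pochhammer s j / fact j) * \<bar>x\<bar> ^ j)"
proof -
  define y where "y = (\<bar>x\<bar> + 1) / 2"
  have y: "\<bar>x\<bar> < y" "y < 1" using assms by (auto simp: y_def)
  have "summable (\<lambda>j. (-s gchoose j) * of_real (-y) ^ j)"
    using gen_binomial_complex[of "of_real (-y)" "-s"] y by (auto simp: sums_iff)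
  hence "summable (\<lambda>j. norm ((-s gchoose j) * of_real x ^ j))"
    by (rule powser_insidea) (use y in auto)
  thus ?thesis
    by (simp add: gbinomial_pochhammer norm_mult norm_power norm_divide)
qed

text \<open>Each (n + 1 + x)^(-s) is expanded around n + 1 by the binomial series, and the two sums
  are exchanged. The damping exp(-e (n + 1)) is left unexpanded, whence the factor
  \<open>exp (e * x)\<close>.\<close>

lemma hsum_expansion:
  fixes x :: real
  assumes ok: "damp_ok e s" and x: "\<bar>x\<bar> < 1"
  shows "(\<lambda>j. pochhammer s j / fact j * of_real (- x) ^ j * hsum e (s + of_nat j) 1)
           sums (of_real (exp (e * x)) * hsum e s (1 + x))"
proof -
  define h where "h j n = pochhammer s j / fact j * of_real (- x) ^ j * kern e (s + of_nat j) (real n + 1)" for j n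
  have hj: "(\<lambda>j. h j n) sums (of_real (exp (e * x)) * kern e s (real n + (1 + x)))" for n
  proof -
    have "(\<lambda>j. (-s gchoose j) * of_real x ^ j * of_real (real n + 1) powr (-s - of_nat j)
             * of_real (exp (- (e * (real n + 1)))))
          sums (of_real (x + (real n + 1)) powr (- s) * of_real (exp (- (e * (real n + 1)))))"
      by (intro sums_mult2 gen_binomial_complex') (use x in auto)
    also have "of_real (x + (real n + 1)) powr (- s) * complex_of_real (exp (- (e * (real n + 1))))
        = of_real (exp (e * x)) * kern e s (real n + (1 + x))"
    proof -
      have "exp (- (e * (real n + 1))) = exp (e * x) * exp (- (e * (real n + (1 + x))))"
        by (simp add: exp_add [symmetric] algebra_simps)
      thus ?thesis by (simp add: kern_def add_ac mult_ac)
    qed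
    also have "(\<lambda>j. (-s gchoose j) * of_real x ^ j * of_real (real n + 1) powr (-s - of_nat j)
             * of_real (exp (- (e * (real n + 1))))) = (\<lambda>j. h j n)"
    proof
      fix j
      show "(-s gchoose j) * of_real x ^ j * of_real (real n + 1) powr (-s - of_nat j)
             * of_real (exp (- (e * (real n + 1)))) = h j n"
        by (simp add: h_def kern_def gbinomial_pochhammer power_minus[of "complex_of_real x"])
    qed
    finally show ?thesis .
  qed
  have "(\<lambda>j. \<Sum>n. h j n) sums (\<Sum>n. \<Sum>j. h j n)"
  proof (rule sums_swap_dominated)
    show "summable (\<lambda>j. norm (pochhammer s j / fact j) * \<bar>x\<bar> ^ j)"
      by (rule pochhammer_power_series[OF x])
    show "summable (\<lambda>n. norm (kern e s (real n + 1)))"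
      by (rule summable_norm_kern[OF _ ok]) simp
    show "norm (h j n) \<le> norm (pochhammer s j / fact j) * \<bar>x\<bar> ^ j * norm (kern e s (real n + 1))" for j n
      unfolding h_def norm_mult norm_power
      by (intro mult_mono order_refl norm_kern_add_nat_le) auto
  qed
  also have "(\<lambda>n. \<Sum>j. h j n) = (\<lambda>n. of_real (exp (e * x)) * kern e s (real n + (1 + x)))"
    using hj by (auto simp: sums_iff)
  also have "(\<Sum>n. of_real (exp (e * x)) * kern e s (real n + (1 + x))) = of_real (exp (e * x)) * hsum e s (1 + x)"
    unfolding hsum_def using x
    by (intro suminf_mult summable_norm_cancel[OF summable_norm_kern[OF _ ok]]) auto
  also have "(\<lambda>j. \<Sum>n. h j n) = (\<lambda>j. pochhammer s j / fact j * of_real (- x) ^ j * hsum e (s + of_nat j) 1)"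
    unfolding h_def hsum_def
    by (intro ext suminf_mult summable_norm_cancel[OF summable_norm_kern] damp_ok_add ok) auto
  finally show ?thesis .
qed

section \<open>The integral over \<open>t > 1/2\<close>\<close>

lemma set_borel_measurable_of_borel:
  fixes f :: "real \<Rightarrow> complex"
  assumes "f \<in> borel_measurable borel" "A \<in> sets borel"
  shows "set_borel_measurable lborel A f"
  using assms unfolding set_borel_measurable_def by auto

lemma borel_measurable_kern [measurable]: "kern e s \<in> borel_measurable borel"
  unfolding kern_def by measurable

lemma set_integrable_lborel_of_lebesgue:
  fixes f :: "real \<Rightarrow> complex"
  assumes "f absolutely_integrable_on A" "f \<in> borel_measurable borel" "A \<in> sets borel"
  shows "set_integrable lborel A f"
proof -
  have "(\<lambda>x. indicat_real A x *\<^sub>R f x) \<in> borel_measurable lborel"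
    using assms(2,3) by auto
  thus ?thesis
    using assms(1) unfolding set_integrable_def by (simp add: integrable_completion)
qed

section \<open>The Gamma integral and the integral over the tail\<close>

lemma set_integrable_kern_Ioi:
  assumes "e > 0" "Re s < 1"
  shows "set_integrable lborel {0<..} (kern e s)"
proof (rule set_integrable_lborel_of_lebesgue)
  have "(\<lambda>t. complex_of_real t powr ((1 - s) - 1) / of_real (exp (e * t))) absolutely_integrable_on {0<..}"
    by (rule absolutely_integrable_Gamma_integral) (use assms in auto)
  thus "kern e s absolutely_integrable_on {0<..}"
    by (simp add: kern_def [abs_def] exp_minus divide_inverse of_real_inverse)
qed auto

lemma set_integral_kern_Ioi:
  assumes e: "e > 0" and s: "Re s < 1"
  shows "(LINT t:{0<..}|lborel. kern e s t) = Gamma (1 - s) * of_real e powr (s - 1)"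
proof -
  have i1: "set_integrable lborel {0<..} (kern 1 s)"
    by (rule set_integrable_kern_Ioi) (use s in auto)
  have "((\<lambda>t. complex_of_real t powr ((1 - s) - 1) / of_real (exp t)) has_integral Gamma (1 - s)) {0<..}"
    by (rule Gamma_integral_complex') (use s in auto)
  hence "(kern 1 s has_integral Gamma (1 - s)) {0<..}"
    by (simp add: kern_def [abs_def] exp_minus divide_inverse of_real_inverse)
  hence "Gamma (1 - s) = (LINT t:{0<..}|lborel. kern 1 s t)"
    using set_borel_integral_eq_integral[OF i1] by (simp add: has_integral_iff)
  also have "\<dots> = e *\<^sub>R (LINT t|lborel. indicat_real {0<..} (0 + e * t) *\<^sub>R kern 1 s (0 + e * t))"
    unfolding set_lebesgue_integral_def
    using lborel_integral_real_affine[of e _ 0] e by simp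
  also have "(\<lambda>t. indicat_real {0<..} (0 + e * t) *\<^sub>R kern 1 s (0 + e * t))
      = (\<lambda>t. of_real e powr (- s) * (indicat_real {0<..} t *\<^sub>R kern e s t))"
  proof
    fix t
    show "indicat_real {0<..} (0 + e * t) *\<^sub>R kern 1 s (0 + e * t) =
        of_real e powr (- s) * (indicat_real {0<..} t *\<^sub>R kern e s t)"
    proof (cases "t > 0")
      case True
      have "(complex_of_real e * of_real t) powr (- s) = of_real e powr (-s) * of_real t powr (-s)"
        by (rule powr_times_real) (use True e in auto)
      thus ?thesis using True e by (simp add: kern_def)
    next
      case False
      thus ?thesis using e by (auto simp: zero_less_mult_iff)
    qed
  qed
  also have "e *\<^sub>R (LINT t|lborel. of_real e powr (- s) * (indicat_real {0<..} t *\<^sub>R kern e s t))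
      = of_real e powr (1 - s) * (LINT t:{0<..}|lborel. kern e s t)"
    using e by (simp add: set_lebesgue_integral_def scaleR_conv_of_real powr_diff powr_minus field_simps)
  finally show ?thesis
    using e powr_minus[of "complex_of_real e" "1 - s"] by (simp add: field_simps)
qed

text \<open>The lower limit 1/2 makes the half line a union of unit cells centred at 1, 2, 3, ...
  and avoids the singularity at 0, so that s is arbitrary when \<open>e > 0\<close>.\<close>

definition tail_integral :: "real \<Rightarrow> complex \<Rightarrow> complex" where
  "tail_integral e s = (LINT t:{1/2<..}|lborel. kern e s t)"

lemma set_integrable_kern_tail:
  assumes ok: "damp_ok e s"
  shows "set_integrable lborel {1/2<..} (kern e s)"
proof (cases "e > 0")
  case True
  define c where "c = \<bar>Re s\<bar>"
  have "set_integrable lborel {0<..} (kern e (of_real (- c)))"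
    by (rule set_integrable_kern_Ioi[OF True]) (auto simp: c_def)
  hence "set_integrable lborel {1/2<..} (kern e (of_real (- c)))"
    by (rule set_integrable_subset) auto
  hence "set_integrable lborel {1/2<..} (\<lambda>t. of_real (4 powr c) * kern e (of_real (- c)) t)"
    by (rule set_integrable_mult_right)
  thus ?thesis
  proof (rule set_integrable_bound)
    show "set_borel_measurable lborel {1/2<..} (kern e s)"
      by (rule set_borel_measurable_of_borel) auto
    \<comment> \<open>With c = |Re s|, the bound by (4 t)^c is clear for t >= 1. For 1/2 < t < 1 it
      follows from t^(-c) <= (4 t)^c, that is, from 1 <= (2 t)^(2 c).\<close>
    have "t powr (- Re s) \<le> 4 powr c * t powr c" if t: "t > 1/2" for t :: real
    proof -
      have "ln t * (- Re s) \<le> c * (ln 4 + ln t)"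
      proof (cases "t \<ge> 1")
        case True
        have "ln t * (- Re s) \<le> ln t * c" using True by (intro mult_left_mono) (auto simp: c_def)
        moreover have "c * ln 4 \<ge> 0" by (simp add: c_def)
        ultimately show ?thesis by (simp add: algebra_simps)
      next
        case False
        have l: "ln t \<ge> - ln 2" "ln t \<le> 0"
          using t False ln_mono[of "1/2" t] by (auto simp: ln_div)
        have "ln (4::real) = 2 * ln 2" using ln_mult[of 2 "2::real"] by simp
        have "ln t * (- Re s) \<le> (- ln t) * c"
          using l by (subst minus_mult_minus[symmetric]) (intro mult_left_mono, auto simp: c_def)
        also have "\<dots> \<le> c * (ln 4 + ln t)"
          using l \<open>ln 4 = 2 * ln 2\<close> mult_left_mono[of 0 "ln 4 + 2 * ln t" c]
          by (simp add: c_def algebra_simps)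
        finally show ?thesis .
      qed
      thus ?thesis using t by (simp add: powr_def exp_add [symmetric] algebra_simps)
    qed
    thus "AE t in lborel. t \<in> {1/2<..} \<longrightarrow> norm (kern e s t) \<le> norm (of_real (4 powr c) * kern e (of_real (- c)) t)"
      by (intro AE_I2) (auto simp: norm_mult norm_kern intro!: mult_right_mono)
  qed
next
  case False
  with ok have e: "e = 0" and s: "Re s > 1" by (auto simp: damp_ok_def)
  have "(\<lambda>x. x powr (- Re s)) integrable_on {1/2..}"
    using has_integral_powr_to_inf[of "- Re s" "1/2"] s by (auto simp: has_integral_iff)
  hence "(\<lambda>x. x powr (- Re s)) absolutely_integrable_on {1/2..}"
    by (intro nonnegative_absolutely_integrable_1) auto
  hence "set_integrable lborel {1/2..} (\<lambda>x. x powr (- Re s))"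
    unfolding set_integrable_def by (subst (asm) integrable_completion) auto
  hence "set_integrable lborel {1/2<..} (\<lambda>x. x powr (- Re s))"
    by (rule set_integrable_subset) auto
  thus ?thesis
  proof (rule set_integrable_bound)
    show "set_borel_measurable lborel {1/2<..} (kern e s)"
      by (rule set_borel_measurable_of_borel) auto
  qed (auto simp: norm_kern e)
qed

lemma kern_tendsto_at_top:
  assumes ok: "damp_ok e s"
  shows "((\<lambda>t. kern e (s - 1) t) \<longlongrightarrow> 0) at_top"
proof (rule tendsto_norm_zero_cancel)
  have "((\<lambda>t. t powr (1 - Re s) * exp (- (e * t))) \<longlongrightarrow> 0) at_top"
    using ok unfolding damp_ok_def
  proof
    assume "e > 0"
    thus ?thesis by real_asymp
  next
    assume a: "e = 0 \<and> Re s > 1"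
    hence "1 - Re s < 0" by simp
    thus ?thesis using a by real_asymp
  qed
  moreover have "eventually (\<lambda>t. norm (kern e (s - 1) t) = t powr (1 - Re s) * exp (- (e * t))) at_top"
    using eventually_gt_at_top[of 0] by eventually_elim (simp add: norm_kern)
  ultimately show "((\<lambda>t. norm (kern e (s - 1) t)) \<longlongrightarrow> 0) at_top"
    by (rule tendsto_cong[THEN iffD2, rotated])
qed

lemma has_vector_derivative_kern:
  assumes t: "t > 0"
  shows "(kern e (s - 1) has_vector_derivative ((1 - s) * kern e s t - of_real e * kern e (s - 1) t)) (at t)"
proof -
  have "((\<lambda>z. z powr (1 - s) * exp (- (of_real e * z))) has_field_derivative
       ((1 - s) * of_real t powr (1 - s - 1) * exp (- (of_real e * of_real t)) 
        + of_real t powr (1 - s) * (exp (- (of_real e * of_real t)) * (- of_real e)))) (at (of_real t))"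
    using t by (auto intro!: derivative_eq_intros simp: complex_nonpos_Reals_iff)
  hence "((\<lambda>z. z powr (1 - s) * exp (- (of_real e * z))) has_field_derivative
       ((1 - s) * kern e s t - of_real e * kern e (s - 1) t)) (at (of_real t))"
    by (rule back_subst) (simp add: kern_def exp_of_real [symmetric] algebra_simps)
  hence "((\<lambda>t. complex_of_real t powr (1 - s) * exp (- (of_real e * of_real t))) has_vector_derivative
       ((1 - s) * kern e s t - of_real e * kern e (s - 1) t)) (at t)"
    by (rule has_vector_derivative_real_field)
  thus ?thesis by (simp add: kern_def [abs_def] exp_of_real [symmetric])
qed

lemma continuous_on_kern: "continuous_on {0<..} (kern e s)"
  unfolding kern_def by (auto intro!: continuous_intros simp: complex_nonpos_Reals_iff)

lemma isCont_kern: "t > 0 \<Longrightarrow> isCont (kern e s) t"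
  using continuous_on_kern[of e s] by (simp add: continuous_on_eq_continuous_at)

text \<open>The fundamental theorem of calculus for t^(1-s) exp(-e t). For \<open>e = 0\<close> the
  integral at s - 1 may diverge, but there it is multiplied by 0.\<close>

lemma tail_integral_recurrence:
  assumes ok: "damp_ok e s"
  shows "(1 - s) * tail_integral e s = of_real e * tail_integral e (s - 1) - kern e (s - 1) (1/2)"
proof -
  let ?f = "\<lambda>t. (1 - s) * kern e s t - of_real e * kern e (s - 1) t"
  have i1: "set_integrable lborel {1/2<..} (\<lambda>t. (1 - s) * kern e s t)"
    using set_integrable_kern_tail[OF ok] by simp
  have i2: "set_integrable lborel {1/2<..} (\<lambda>t. of_real e * kern e (s - 1) t)"
  proof (cases "e = 0")
    case False
    hence "damp_ok e (s - 1)" using ok by (auto simp: damp_ok_def)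
    from set_integrable_kern_tail[OF this] show ?thesis by simp
  qed (simp add: set_integrable_def)
  have "interval_lebesgue_integral lborel (ereal (1/2)) \<infinity> ?f = 0 - kern e (s - 1) (1/2)"
  proof (rule interval_integral_FTC_integrable)
    show "(kern e (s - 1) has_vector_derivative ?f x) (at x)" if "ereal (1/2) < ereal x" for x
      using that by (intro has_vector_derivative_kern) auto
    show "isCont ?f x" if "ereal (1/2) < ereal x" for x
      using that by (intro continuous_intros isCont_kern) auto
    show "set_integrable lborel (einterval (ereal (1/2)) \<infinity>) ?f"
      unfolding einterval_eq_Ici by (rule set_integral_diff(1)[OF i1 i2])
    have "isCont (kern e (s - 1)) (1/2)" by (rule isCont_kern) simp
    thus "((kern e (s - 1) \<circ> real_of_ereal) \<longlongrightarrow> kern e (s - 1) (1/2)) (at_right (ereal (1/2)))"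
      by (simp add: ereal_tendsto_simps isCont_def filterlim_at_split)
    show "((kern e (s - 1) \<circ> real_of_ereal) \<longlongrightarrow> 0) (at_left \<infinity>)"
      using kern_tendsto_at_top[OF ok] by (simp add: ereal_tendsto_simps)
  qed auto
  hence "(LINT t:{1/2<..}|lborel. ?f t) = - kern e (s - 1) (1/2)"
    by (simp add: interval_integral_to_infinity_eq)
  also have "(LINT t:{1/2<..}|lborel. ?f t) = (1 - s) * tail_integral e s - of_real e * tail_integral e (s - 1)"
    unfolding tail_integral_def by (subst set_integral_diff(2)[OF i1 i2]) simp
  finally show ?thesis by (simp add: algebra_simps)
qed

lemma tail_integral_0:
  assumes "Re s > 1"
  shows "tail_integral 0 s = (1/2) powr (1 - s) / (s - 1)"
proof -
  have "s \<noteq> 1" using assms by auto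
  thus ?thesis
    using tail_integral_recurrence[of 0 s] assms by (auto simp: damp_ok_def kern_def field_simps)
qed

section \<open>Expansion around the integers\<close>

text \<open>The factor that the j-th term of \<open>hsum_expansion\<close> acquires when integrated
  over the cell around 1. The exponential undoes the factor \<open>exp (e * x)\<close> of that
  expansion.\<close>

definition moment :: "real \<Rightarrow> nat \<Rightarrow> complex" where
  "moment e j = (LINT x:{-1/2<..<1/2}|lborel. of_real (exp (- (e * x)) * (- x) ^ j))"

lemma set_integrable_bounded_interval:
  fixes f :: "real \<Rightarrow> complex"
  assumes "f \<in> borel_measurable borel" "\<And>x. x \<in> {a<..<b} \<Longrightarrow> norm (f x) \<le> C"
  shows "set_integrable lborel {a<..<b} f"
proof (rule set_integrable_bound)
  show "set_integrable lborel {a<..<b} (\<lambda>x. C)"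
    by (rule set_integrable_const_interval)
  show "set_borel_measurable lborel {a<..<b} f"
    by (rule set_borel_measurable_of_borel) (use assms in auto)
qed (use assms(2) in \<open>force intro!: AE_I2\<close>)

lemma norm_moment_integrand_le:
  assumes "x \<in> {-1/2<..<1/2}" "e \<ge> 0"
  shows "norm (complex_of_real (exp (- (e * x)) * (- x) ^ j)) \<le> exp e * (1/2) ^ j"
proof -
  have "- (e * x) \<le> e * \<bar>x\<bar>" using assms mult_left_mono[of "-x" "\<bar>x\<bar>" e] by simp
  also have "\<dots> \<le> e * 1" using assms by (intro mult_left_mono) auto
  finally have "exp (- (e * x)) * \<bar>x\<bar> ^ j \<le> exp e * (1/2) ^ j"
    using assms by (intro mult_mono power_mono) auto
  thus ?thesis by (simp add: norm_mult norm_power)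
qed

lemma set_integrable_moment:
  assumes "e \<ge> 0"
  shows "set_integrable lborel {-1/2<..<1/2} (\<lambda>x. complex_of_real (exp (- (e * x)) * (- x) ^ j))"
  by (rule set_integrable_bounded_interval[OF _ norm_moment_integrand_le[OF _ assms]]) auto

lemma norm_moment_le:
  assumes "e \<ge> 0"
  shows "norm (moment e j) \<le> exp e * (1/2) ^ j"
proof -
  let ?f = "\<lambda>x. complex_of_real (exp (- (e * x)) * (- x) ^ j)"
  have c: "set_integrable lborel {-1/2<..<1/2} (\<lambda>x::real. exp e * (1/2) ^ j)"
    by (rule set_integrable_const_interval)
  have "norm (moment e j) \<le> (LINT x:{-1/2<..<1/2}|lborel. norm (?f x))"
    unfolding moment_def by (rule set_integral_norm_bound[OF set_integrable_moment[OF assms]])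
  also have "\<dots> \<le> (LINT x:{-1/2<..<1/2::real}|lborel. exp e * (1/2) ^ j)"
    by (intro set_integral_mono set_integrable_norm set_integrable_moment assms c norm_moment_integrand_le)
  also have "\<dots> = exp e * (1/2) ^ j"
    by (simp add: set_lebesgue_integral_def)
  finally show ?thesis .
qed

lemma moment_0_0: "moment 0 0 = 1"
  by (simp add: moment_def set_lebesgue_integral_def)

lemma continuous_moment:
  assumes "\<And>i. 0 \<le> e i" "\<And>i. e i \<le> 1" "e \<longlonglongrightarrow> 0"
  shows "(\<lambda>i. moment (e i) j) \<longlonglongrightarrow> moment 0 j"
  unfolding moment_def
proof (rule set_integral_LIMSEQ_dominated)
  show "set_borel_measurable lborel {-1/2<..<1/2} (\<lambda>x. complex_of_real (exp (- (e i * x)) * (- x) ^ j))" for i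
    by (rule set_borel_measurable_of_borel) auto
  show "set_integrable lborel {-1/2<..<1/2} (\<lambda>x::real. exp 1 * (1/2) ^ j)"
    by (rule set_integrable_const_interval)
  fix x :: real assume x: "x \<in> {-1/2<..<1/2}"
  show "(\<lambda>i. complex_of_real (exp (- (e i * x)) * (- x) ^ j)) \<longlonglongrightarrow> complex_of_real (exp (- (0 * x)) * (- x) ^ j)"
    by (intro tendsto_intros assms)
  show "norm (complex_of_real (exp (- (e i * x)) * (- x) ^ j)) \<le> exp 1 * (1/2) ^ j" for i
    by (rule order_trans[OF norm_moment_integrand_le[OF x assms(1)]]) (use assms(2) in auto)
qed auto

lemma borel_measurable_hsum [measurable]: "hsum e s \<in> borel_measurable borel"
  unfolding hsum_def by measurable

text \<open>Integrating the n-th summand over one cell is integrating \<open>kern e s\<close> over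
  the cell around n + 1, and these cells fill t > 1/2.\<close>

lemma integral_hsum_cell:
  assumes ok: "damp_ok e s"
  shows "(LINT x:{-1/2<..<1/2}|lborel. hsum e s (1 + x)) = tail_integral e s"
proof -
  have ge: "e \<ge> 0" using ok by (auto simp: damp_ok_def)
  have "(\<lambda>n. LINT x:{1/2<..<1/2+1}|lborel. kern e s (real n + x)) sums tail_integral e s"
    unfolding tail_integral_def by (rule set_integral_unit_cells[OF set_integrable_kern_tail[OF ok]])
  moreover have "(\<lambda>n. LINT x:{1/2<..<1/2+1}|lborel. kern e s (real n + x)) sums
                 (LINT x:{1/2<..<1/2+1}|lborel. hsum e s x)"
  proof (rule set_integral_sums_dominated)
    \<comment> \<open>On a cell the power is monotone, so whatever the sign of Re s it is at most
      the sum of its endpoint values. The factor \<open>exp e\<close> compensates for writing the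
      damping at the right endpoint instead of the left.\<close>
    define M' where "M' n = norm (kern e s (real n + 1/2)) + exp e * norm (kern e s (real n + 3/2))" for n
    have M': "summable M'"
      unfolding M'_def by (intro summable_add summable_mult summable_norm_kern ok) auto
    have bd: "norm (kern e s (real n + x)) \<le> M' n" if x: "x \<in> {1/2<..<1/2+1}" for x n
    proof -
      have "(real n + x) powr (- Re s) \<le> (real n + 1/2) powr (- Re s) + (real n + 3/2) powr (- Re s)"
      proof (cases "Re s \<ge> 0")
        case True
        hence "(real n + x) powr (- Re s) \<le> (real n + 1/2) powr (- Re s)"
          using x by (intro powr_mono2') auto
        thus ?thesis by (simp add: add_increasing2)
      next
        case False
        hence "(real n + x) powr (- Re s) \<le> (real n + 3/2) powr (- Re s)"
          using x by (intro powr_mono2) auto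
        thus ?thesis by (simp add: add_increasing)
      qed
      moreover have "exp (- (e * (real n + x))) \<le> exp (- (e * (real n + 1/2)))"
        using x ge by (auto intro!: mult_left_mono)
      ultimately have "norm (kern e s (real n + x)) \<le> 
          ((real n + 1/2) powr (- Re s) + (real n + 3/2) powr (- Re s)) * exp (- (e * (real n + 1/2)))"
        using x by (auto simp: norm_kern intro!: mult_mono)
      also have "\<dots> = M' n"
        using x by (auto simp: norm_kern M'_def exp_add [symmetric] algebra_simps)
      finally show ?thesis .
    qed
    show "(\<lambda>n. kern e s (real n + x)) sums hsum e s x" if x: "x \<in> {1/2<..<1/2+1}" for x
      unfolding hsum_def using x
      by (intro summable_sums summable_norm_cancel[OF summable_norm_kern[OF _ ok]]) auto
    show "(\<Sum>n<N. norm (kern e s (real n + x))) \<le> (\<Sum>n. M' n)" if x: "x \<in> {1/2<..<1/2+1}" for x N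
    proof -
      have "(\<Sum>n<N. norm (kern e s (real n + x))) \<le> (\<Sum>n<N. M' n)"
        by (intro sum_mono bd x)
      also have "\<dots> \<le> (\<Sum>n. M' n)"
        by (rule sum_le_suminf[OF M']) (simp_all add: M'_def)
      finally show ?thesis .
    qed
    show "set_integrable lborel {1/2<..<1/2+1} (\<lambda>x::real. \<Sum>n. M' n)"
      by (rule set_integrable_const_interval)
    show "set_borel_measurable lborel {1/2<..<1/2+1} (\<lambda>x. kern e s (real n + x))" for n
      by (rule set_borel_measurable_of_borel) auto
  qed auto
  ultimately have "(LINT x:{1/2<..<1/2+1}|lborel. hsum e s x) = tail_integral e s"
    by (rule sums_unique2[symmetric])
  thus ?thesis
    using set_integral_shift(2)[of "-1/2" "1/2" "hsum e s" 1] by simp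
qed

text \<open>\<open>hsum_expansion\<close> is integrated termwise over |x| < 1/2. Only the term j = 0
  involves the value at s itself, so the identity can be solved for it; this drives both the
  continuation and the limit in e.\<close>

lemma midpoint_expansion:
  assumes ok: "damp_ok e s"
  shows "(\<lambda>j. pochhammer s j / fact j * hsum e (s + of_nat j) 1 * moment e j) sums tail_integral e s"
proof -
  have ge: "e \<ge> 0" using ok by (auto simp: damp_ok_def)
  define Z where "Z = (\<Sum>n. norm (kern e s (real n + 1)))"
  define c where "c j = pochhammer s j / fact j * hsum e (s + of_nat j) 1" for j
  have c: "norm (c j) \<le> norm (pochhammer s j / fact j) * Z" for j
    unfolding c_def Z_def norm_mult by (intro mult_left_mono norm_hsum_add_nat_le ok) auto
  have Z: "Z \<ge> 0" unfolding Z_def by (intro suminf_nonneg summable_norm_kern ok) auto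
  have S: "summable (\<lambda>j. norm (pochhammer s j / fact j) * (1/2) ^ j)"
    using pochhammer_power_series[of "1/2" s] by simp
  let ?g = "\<lambda>j x. complex_of_real (exp (- (e * x)) * (- x) ^ j)"
  have "(\<lambda>j. LINT x:{-1/2<..<1/2}|lborel. c j * ?g j x) sums (LINT x:{-1/2<..<1/2}|lborel. hsum e s (1 + x))"
  proof (rule set_integral_sums_dominated)
    show "set_borel_measurable lborel {-1/2<..<1/2} (\<lambda>x. c j * ?g j x)" for j
      by (rule set_borel_measurable_of_borel) auto
    show "(\<lambda>j. c j * ?g j x) sums hsum e s (1 + x)" if x: "x \<in> {-1/2<..<1/2}" for x
    proof -
      have "(\<lambda>j. of_real (exp (- (e * x))) * (pochhammer s j / fact j * of_real (- x) ^ j * hsum e (s + of_nat j) 1))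
           sums (of_real (exp (- (e * x))) * (of_real (exp (e * x)) * hsum e s (1 + x)))"
        by (intro sums_mult hsum_expansion ok) (use x in auto)
      also have "of_real (exp (- (e * x))) * (of_real (exp (e * x)) * hsum e s (1 + x)) = hsum e s (1 + x)"
        by (simp flip: mult.assoc of_real_mult exp_add)
      finally show ?thesis by (simp add: c_def mult_ac)
    qed
    show "(\<Sum>j<N. norm (c j * ?g j x)) \<le> exp e * Z * (\<Sum>j. norm (pochhammer s j / fact j) * (1/2) ^ j)"
      if x: "x \<in> {-1/2<..<1/2}" for x N
    proof -
      have "(\<Sum>j<N. norm (c j * ?g j x)) \<le> (\<Sum>j<N. exp e * Z * (norm (pochhammer s j / fact j) * (1/2) ^ j))"
      proof (rule sum_mono)
        fix j
        have "norm (c j * ?g j x) \<le> (norm (pochhammer s j / fact j) * Z) * (exp e * (1/2) ^ j)"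
          unfolding norm_mult[of "c j"] using Z
          by (intro mult_mono c norm_moment_integrand_le x ge) auto
        thus "norm (c j * ?g j x) \<le> exp e * Z * (norm (pochhammer s j / fact j) * (1/2) ^ j)"
          by (simp add: mult_ac)
      qed
      also have "\<dots> = exp e * Z * (\<Sum>j<N. norm (pochhammer s j / fact j) * (1/2) ^ j)"
        by (simp add: sum_distrib_left)
      also have "\<dots> \<le> exp e * Z * (\<Sum>j. norm (pochhammer s j / fact j) * (1/2) ^ j)"
        using Z S by (intro mult_left_mono sum_le_suminf) auto
      finally show ?thesis .
    qed
    show "set_integrable lborel {-1/2<..<1/2} (\<lambda>x::real. exp e * Z * (\<Sum>j. norm (pochhammer s j / fact j) * (1/2) ^ j))"
      by (rule set_integrable_const_interval)
  qed auto
  also have "(\<lambda>j. LINT x:{-1/2<..<1/2}|lborel. c j * ?g j x) = (\<lambda>j. c j * moment e j)"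
    unfolding moment_def by (subst set_integral_mult_right) auto
  finally show ?thesis
    unfolding c_def integral_hsum_cell[OF ok] .
qed

section \<open>Analytic continuation of the zeta function\<close>

text \<open>The number zeta(2), a bound for \<open>hsum e s 1\<close> uniform in e >= 0 and Re s >=
  2.\<close>

definition zeta2_bound :: real where
  "zeta2_bound = (\<Sum>n. (real n + 1) powr (- 2))"

lemma summable_zeta2: "summable (\<lambda>n. (real n + 1) powr (- 2))"
  using summable_norm_kern[of 1 0 2] by (simp add: damp_ok_def norm_kern)

lemma zeta2_bound_nonneg: "zeta2_bound \<ge> 0"
  unfolding zeta2_bound_def by (intro suminf_nonneg summable_zeta2) auto

lemma norm_hsum_le_zeta2_bound:
  assumes e: "e \<ge> 0" and s: "Re s \<ge> 2"
  shows "norm (hsum e s 1) \<le> zeta2_bound"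
proof -
  have ok: "damp_ok e s" using assms by (auto simp: damp_ok_def)
  have "norm (hsum e s 1) \<le> (\<Sum>n. norm (kern e s (real n + 1)))"
    unfolding hsum_def by (intro summable_norm summable_norm_kern ok) auto
  also have "\<dots> \<le> zeta2_bound"
    unfolding zeta2_bound_def
  proof (intro suminf_le summable_norm_kern ok summable_zeta2)
    fix n
    have "(real n + 1) powr (- Re s) * exp (- (e * (real n + 1))) \<le> (real n + 1) powr (- 2) * 1"
      using s e by (intro mult_mono powr_mono) auto
    thus "norm (kern e s (real n + 1)) \<le> (real n + 1) powr (- 2)"
      by (simp add: norm_kern)
  qed auto
  finally show ?thesis .
qed

lemma norm_pochhammer_le:
  assumes "norm s \<le> R"
  shows "norm (pochhammer (s :: complex) j) \<le> pochhammer R j"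
  unfolding pochhammer_prod prod_norm [symmetric]
proof (intro prod_mono conjI)
  fix i
  show "norm (s + of_nat i) \<le> R + real i"
    using norm_triangle_ineq[of s "of_nat i"] assms by simp
qed auto

text \<open>
  The approximation \<open>xi_approx k\<close> continues \<open>(s - 1) \<zeta>(s)\<close> to \<open>Re s > 1 - k\<close>. The factor \<open>s - 1\<close> keeps the
  recursion free of poles: \<open>(s)\<^sub>j\<^sub>+\<^sub>1 \<zeta>(s + j + 1) = (s)\<^sub>j \<xi>(s + j + 1)\<close>, also where the left side is a limiting value.
\<close>

primrec xi_approx :: "nat \<Rightarrow> complex \<Rightarrow> complex" where
  "xi_approx 0 s = (s - 1) * hsum 0 s 1"
| "xi_approx (Suc k) s = 2 powr (s - 1) - (s - 1) *
     (\<Sum>j. pochhammer s j / fact (Suc j) * xi_approx k (s + of_nat (Suc j)) * moment 0 (Suc j))"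

text \<open>Solving \<open>midpoint_expansion\<close> at \<open>e = 0\<close> for its term j = 0 and
  multiplying by s - 1 gives exactly the recursion.\<close>

lemma xi_approx_1:
  assumes s: "Re s > 1"
  shows "xi_approx (Suc 0) s = xi_approx 0 s"
proof -
  have s1: "s \<noteq> 1" using s by auto
  have ok: "damp_ok 0 s" using s by (simp add: damp_ok_def)
  have "(\<lambda>j. pochhammer s (Suc j) / fact (Suc j) * hsum 0 (s + of_nat (Suc j)) 1 * moment 0 (Suc j))
       sums (tail_integral 0 s - pochhammer s 0 / fact 0 * hsum 0 (s + of_nat 0) 1 * moment 0 0)"
    using midpoint_expansion[OF ok] by (subst sums_Suc_iff) simp
  also have "tail_integral 0 s - pochhammer s 0 / fact 0 * hsum 0 (s + of_nat 0) 1 * moment 0 0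
      = (1/2) powr (1 - s) / (s - 1) - hsum 0 s 1"
    by (simp add: tail_integral_0[OF s] moment_0_0)
  also have "(1/2 :: complex) powr (1 - s) = 2 powr (s - 1)"
    using Ln_inverse[of 2] by (simp add: powr_def inverse_eq_divide algebra_simps)
  \<comment> \<open>(s)_(j+1) = (s)_j (s + j), and s + j is the factor that
    \<open>xi_approx 0\<close> contributes at the argument s + j + 1.\<close>
  also have "(\<lambda>j. pochhammer s (Suc j) / fact (Suc j) * hsum 0 (s + of_nat (Suc j)) 1 * moment 0 (Suc j))
     = (\<lambda>j. pochhammer s j / fact (Suc j) * xi_approx 0 (s + of_nat (Suc j)) * moment 0 (Suc j))"
    by (simp add: pochhammer_Suc mult_ac)
  finally show ?thesis using s1 by (simp add: sums_iff field_simps)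
qed

text \<open>The recursion at s only calls arguments of real part at least Re s + 1, where the
  induction hypothesis applies.\<close>

lemma xi_approx_Suc_eq:
  assumes "Re s > 1 - real k"
  shows "xi_approx (Suc k) s = xi_approx k s"
  using assms
proof (induction k arbitrary: s)
  case 0
  thus ?case using xi_approx_1[of s] by simp
next
  case (Suc k)
  have "xi_approx (Suc k) (s + of_nat (Suc j)) = xi_approx k (s + of_nat (Suc j))" for j
    by (rule Suc.IH) (use Suc.prems in auto)
  thus ?case by (simp only: xi_approx.simps(2)[of "Suc k"] xi_approx.simps(2)[of k s])
qed

lemma xi_approx_eq:
  assumes "Re s > 1 - real k" "k \<le> m"
  shows "xi_approx m s = xi_approx k s"
  using assms(2)
proof (induction m rule: dec_induct)
  case (step m)
  thus ?case using xi_approx_Suc_eq[of m s] assms(1) by simp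
qed auto

lemma hsum_0_holomorphic: "(\<lambda>s. hsum 0 s 1) holomorphic_on {s. Re s > 1}"
proof (rule holomorphic_uniform_sequence)
  show "open {s. Re s > 1}" by (rule open_halfspace_Re_gt)
  show "(\<lambda>s. \<Sum>n<N. kern 0 s (real n + 1)) holomorphic_on {s. Re s > 1}" for N
    unfolding kern_def by (intro holomorphic_intros)
  fix z assume "z \<in> {s. Re s > 1}"
  then obtain d where d: "d > 0" "cball z d \<subseteq> {s. Re s > 1}"
    using open_halfspace_Re_gt open_contains_cball by metis
  \<comment> \<open>The real part of the leftmost point of the disc. This point lies in the half
    plane, so c > 1 and (n + 1)^(-c) is a summable majorant on the disc.\<close>
  define c where "c = Re z - d"
  have "z - of_real d \<in> cball z d" using d by (simp add: dist_norm)
  hence "z - of_real d \<in> {s. Re s > 1}" using d(2) by blast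
  hence c: "c > 1" by (simp add: c_def)
  have "uniform_limit (cball z d) (\<lambda>N s. \<Sum>n<N. kern 0 s (real n + 1)) (\<lambda>s. \<Sum>n. kern 0 s (real n + 1)) sequentially"
  proof (rule Weierstrass_m_test)
    fix n s assume "s \<in> cball z d"
    hence "\<bar>Re (z - s)\<bar> \<le> d" using abs_Re_le_cmod[of "z - s"] by (simp add: dist_norm)
    hence "Re s \<ge> c" by (simp add: c_def)
    thus "norm (kern 0 s (real n + 1)) \<le> (real n + 1) powr (- c)"
      by (auto simp: norm_kern intro!: powr_mono)
  next
    show "summable (\<lambda>n. (real n + 1) powr (- c))"
      using summable_norm_kern[of 1 0 "of_real c"] c by (simp add: damp_ok_def norm_kern)
  qed
  thus "\<exists>d>0. cball z d \<subseteq> {s. Re s > 1} \<and>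
      uniform_limit (cball z d) (\<lambda>N s. \<Sum>n<N. kern 0 s (real n + 1)) (\<lambda>s. hsum 0 s 1) sequentially"
    unfolding hsum_def using d by blast
qed

text \<open>The series converges locally uniformly: all but finitely many terms are evaluated at
  real part above 2, where \<open>xi_approx k\<close> still agrees with the Dirichlet series, and
  the moments contribute a geometric factor.\<close>

lemma xi_approx_holomorphic: "xi_approx k holomorphic_on {s. Re s > 1 - real k}"
proof (induction k)
  case 0
  have "(\<lambda>s. (s - 1) * hsum 0 s 1) holomorphic_on {s. Re s > 1}"
    by (intro holomorphic_intros hsum_0_holomorphic)
  thus ?case by simp
next
  case (Suc k)
  let ?S = "{s. Re s > 1 - real (Suc k)}"
  let ?h = "\<lambda>j s. pochhammer s j / fact (Suc j) * xi_approx k (s + of_nat (Suc j)) * moment 0 (Suc j)"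
  have op: "open ?S" by (rule open_halfspace_Re_gt)
  have "(\<lambda>s. \<Sum>j. ?h j s) holomorphic_on ?S"
  proof (rule holomorphic_uniform_sequence[OF op])
    have "(\<lambda>s. xi_approx k (s + of_nat (Suc j))) holomorphic_on ?S" for j
    proof -
      have "(xi_approx k \<circ> (\<lambda>s. s + of_nat (Suc j))) holomorphic_on ?S"
        by (rule holomorphic_on_compose_gen[OF _ Suc.IH]) (auto intro!: holomorphic_intros)
      thus ?thesis by (simp add: o_def)
    qed
    thus "(\<lambda>s. \<Sum>j<N. ?h j s) holomorphic_on ?S" for N
      unfolding pochhammer_prod by (intro holomorphic_intros) auto
    fix z assume "z \<in> ?S"
    then obtain d where d: "d > 0" "cball z d \<subseteq> ?S"
      using op open_contains_cball by metis
    \<comment> \<open>R bounds |s| on the disc, hence \<open>pochhammer R j\<close> bounds |(s)_j|,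
      and the majorant becomes a binomial series at 1/2.\<close>
    define R where "R = norm z + d"
    have "uniform_limit (cball z d) (\<lambda>N s. \<Sum>j<N. ?h j s) (\<lambda>s. \<Sum>j. ?h j s) sequentially"
    proof (rule Weierstrass_m_test_ev)
      have R: "R > 0" using d by (simp add: R_def add_nonneg_pos)
      have "summable (\<lambda>j. norm (pochhammer (complex_of_real R) (Suc j) / fact (Suc j)) * (1/2) ^ Suc j)"
        by (subst summable_Suc_iff) (use pochhammer_power_series[of "1/2" "of_real R"] in simp)
      moreover have "norm (pochhammer (complex_of_real R) j) = pochhammer R j" for j
        using R by (simp add: pochhammer_of_real pochhammer_nonneg)
      ultimately have "summable (\<lambda>j. pochhammer R (Suc j) / fact (Suc j) * (1/2) ^ Suc j)"
        by (simp only: norm_divide norm_fact)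
      thus "summable (\<lambda>j. zeta2_bound * (pochhammer R (Suc j) / fact (Suc j) * (1/2) ^ Suc j))"
        by (rule summable_mult)
      show "eventually (\<lambda>j. \<forall>s\<in>cball z d. norm (?h j s) \<le>
              zeta2_bound * (pochhammer R (Suc j) / fact (Suc j) * (1/2) ^ Suc j)) sequentially"
        using eventually_ge_at_top[of "k + 1"]
      proof eventually_elim
        case (elim j)
        show ?case
        proof
          fix s assume s: "s \<in> cball z d"
          have nR: "norm s \<le> R"
            using s norm_triangle_ineq2[of s z] by (simp add: R_def dist_norm norm_minus_commute)
          have "Re s > - real k" using s d by auto
          hence re: "Re (s + of_nat (Suc j)) > 2" using elim by simp
          have "xi_approx k (s + of_nat (Suc j)) = xi_approx 0 (s + of_nat (Suc j))"
            by (rule xi_approx_eq) (use re in auto)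
          also have "\<dots> = (s + of_nat j) * hsum 0 (s + of_nat (Suc j)) 1" by simp
          finally have "?h j s = pochhammer s (Suc j) / fact (Suc j) * hsum 0 (s + of_nat (Suc j)) 1 * moment 0 (Suc j)"
            by (simp add: pochhammer_Suc)
          hence "norm (?h j s) = norm (pochhammer s (Suc j)) / fact (Suc j)
                   * norm (hsum 0 (s + of_nat (Suc j)) 1) * norm (moment 0 (Suc j))"
            by (simp only: norm_mult norm_divide norm_fact)
          also have "\<dots> \<le> pochhammer R (Suc j) / fact (Suc j) * zeta2_bound * (1/2) ^ Suc j"
            using norm_moment_le[of 0 "Suc j"] norm_pochhammer_le[OF nR] R zeta2_bound_nonneg re
            by (intro mult_mono divide_right_mono norm_hsum_le_zeta2_bound) (auto simp: pochhammer_nonneg)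
          finally show "norm (?h j s) \<le> zeta2_bound * (pochhammer R (Suc j) / fact (Suc j) * (1/2) ^ Suc j)"
            by (simp add: mult_ac)
        qed
      qed
    qed
    with d show "\<exists>d>0. cball z d \<subseteq> ?S \<and>
        uniform_limit (cball z d) (\<lambda>N s. \<Sum>j<N. ?h j s) (\<lambda>s. \<Sum>j. ?h j s) sequentially"
      by blast
  qed
  hence "(\<lambda>s. 2 powr (s - 1) - (s - 1) * (\<Sum>j. ?h j s)) holomorphic_on ?S"
    by (intro holomorphic_intros) auto
  thus ?case by simp
qed

section \<open>The entire function (s - 1) zeta(s) and the zeta function\<close>

text \<open>Every level k with Re s > 1 - k gives the same value; the ceiling is increased by 1 to
  make this inequality strict.\<close>

definition xi :: "complex \<Rightarrow> complex" where
  "xi s = xi_approx (nat (\<lceil>1 - Re s\<rceil> + 1)) s"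

lemma xi_eq_approx:
  assumes "Re s > 1 - real k"
  shows "xi s = xi_approx k s"
proof -
  define m where "m = nat (\<lceil>1 - Re s\<rceil> + 1)"
  have "Re s > 1 - real m"
    unfolding m_def by linarith
  thus ?thesis
    using xi_approx_eq[of m s "max k m"] xi_approx_eq[OF assms, of "max k m"]
    by (simp add: xi_def m_def)
qed

lemma xi_holomorphic: "xi holomorphic_on UNIV"
proof -
  have "xi holomorphic_on {s. Re s > 1 - real k}" for k
    using xi_approx_holomorphic[of k] by (rule holomorphic_transform) (auto simp: xi_eq_approx)
  hence "xi holomorphic_on (\<Union>k. {s. Re s > 1 - real k})"
    by (intro holomorphic_on_UN_open) (auto intro: open_halfspace_Re_gt)
  moreover have "s \<in> (\<Union>k. {s. Re s > 1 - real k})" for s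
    using reals_Archimedean2[of "1 - Re s"] by (auto simp: algebra_simps)
  ultimately show ?thesis by (metis UNIV_eq_I)
qed

lemma xi_recurrence:
  "xi s = 2 powr (s - 1) - (s - 1) *
     (\<Sum>j. pochhammer s j / fact (Suc j) * xi (s + of_nat (Suc j)) * moment 0 (Suc j))"
proof -
  obtain k where k: "1 - Re s < real k" using reals_Archimedean2 by blast
  have "xi (s + of_nat (Suc j)) = xi_approx k (s + of_nat (Suc j))" for j
    by (rule xi_eq_approx) (use k in auto)
  moreover have "xi s = xi_approx (Suc k) s"
    by (rule xi_eq_approx) (use k in auto)
  ultimately show ?thesis by simp
qed

lemma xi_1: "xi 1 = 1"
  by (subst xi_recurrence) simp

lemma xi_eq_hsum: "Re s > 1 \<Longrightarrow> xi s = (s - 1) * hsum 0 s 1"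
  using xi_eq_approx[of 0 s] by simp

text \<open>Resolves the definite description: \<open>xi s / (s - 1)\<close> gives existence, and
  analytic continuation from Re s > 1 in the connected punctured plane gives uniqueness.\<close>

lemma zeta_eq_xi:
  "zeta = (\<lambda>s. if s = 1 then 0 else xi s / (s - 1))"
  unfolding zeta_def
proof (rule the_equality, intro conjI allI impI)
  let ?z = "\<lambda>s. if s = 1 then 0 else xi s / (s - 1)"
  have "(\<lambda>s. xi s / (s - 1)) holomorphic_on (- {1})"
    by (intro holomorphic_intros holomorphic_on_subset[OF xi_holomorphic]) auto
  thus hol: "?z holomorphic_on (- {1})"
    by (rule holomorphic_transform) auto
  show dir: "?z s = (\<Sum>n. of_nat (Suc n) powr (- s))" if "Re s > 1" for s
    using that by (auto simp: xi_eq_hsum hsum_def kern_def add_ac)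
  fix f assume f: "f holomorphic_on (- {1}) \<and> (\<forall>s. Re s > 1 \<longrightarrow> f s = (\<Sum>n. of_nat (Suc n) powr (- s))) \<and> f 1 = 0"
  have "f s = ?z s" if s: "s \<noteq> 1" for s
  proof (rule analytic_continuation_open[of "{s. Re s > 1}" "- {1}" f ?z])
    show "open {s. Re s > 1}" by (rule open_halfspace_Re_gt)
    show "connected (- {1 :: complex})" by (rule connected_punctured_universe) simp
    have "2 \<in> {s. Re s > 1}" by simp
    thus "{s. Re s > 1} \<noteq> {}" by blast
    show "f z = ?z z" if "z \<in> {s. Re s > 1}" for z
      using that f dir[of z] by auto
  qed (use f hol s in auto)
  thus "f = ?z" using f by auto
qed simp

lemma zeta_eq_hsum: "Re s > 1 \<Longrightarrow> zeta s = hsum 0 s 1"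
  by (auto simp: zeta_eq_xi xi_eq_hsum)

lemma pochhammer_zeta_0: "pochhammer_zeta s 0 = zeta s"
  by (simp add: pochhammer_zeta_def)

text \<open>Removes the case distinction at the pole. For s + j nonzero, this factor of (s)_(j+1)
  cancels the denominator of zeta; for s = -j, \<open>xi 1 = 1\<close> leaves (-j)_j = (-1)^j j!,
  the limiting value.\<close>

lemma pochhammer_zeta_Suc: "pochhammer_zeta s (Suc j) = pochhammer s j * xi (s + of_nat (Suc j))"
proof (cases "s = - of_nat j")
  case True
  thus ?thesis by (simp add: pochhammer_zeta_def xi_1 pochhammer_same)
next
  case False
  hence "s + of_nat (Suc j) \<noteq> 1" by (auto simp: add_eq_0_iff2)
  thus ?thesis using False by (auto simp: pochhammer_zeta_def zeta_eq_xi pochhammer_Suc)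
qed

lemma zeta_midpoint_expansion:
  assumes "s \<noteq> 1"
  shows "zeta s = 2 powr (s - 1) / (s - 1) -
     (\<Sum>j. pochhammer_zeta s (Suc j) / fact (Suc j) * moment 0 (Suc j))"
proof -
  have "zeta s = xi s / (s - 1)" using assms by (simp add: zeta_eq_xi)
  also have "\<dots> = 2 powr (s - 1) / (s - 1) -
     (\<Sum>j. pochhammer s j / fact (Suc j) * xi (s + of_nat (Suc j)) * moment 0 (Suc j))"
    by (subst xi_recurrence) (use assms in \<open>simp add: diff_divide_distrib\<close>)
  finally show ?thesis by (simp add: pochhammer_zeta_Suc)
qed

section \<open>Damped coefficients and their limits\<close>

text \<open>A sequence replaces the limit of real e to 0, so that sequential dominated convergence
  applies.\<close>

definition eps :: "nat \<Rightarrow> real" where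
  "eps i = 1 / real (Suc i)"

lemma eps_pos: "eps i > 0" and eps_le_1: "eps i \<le> 1"
  by (auto simp: eps_def)

lemma eps_tendsto_0: "eps \<longlonglongrightarrow> 0"
  using LIMSEQ_inverse_real_of_nat unfolding eps_def [abs_def] inverse_eq_divide .

text \<open>
  If \<open>s + j\<close> is not a positive integer, this is \<open>(s)\<^sub>j (\<Sum>\<^sub>n n\<^sup>-\<^sup>s\<^sup>-\<^sup>j exp (- e n) - \<Gamma>(1 - s - j) e\<^sup>s\<^sup>+\<^sup>j\<^sup>-\<^sup>1)\<close> by the
  reflection \<open>(-1)\<^sup>j \<Gamma>(1 - s) = (s)\<^sub>j \<Gamma>(1 - s - j)\<close>; the form chosen makes sense for \<open>s = 0, -1, -2, \<dots>\<close> as well,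
  where the second term produces the limiting value of \<open>(s)\<^sub>j \<zeta>(s + j)\<close> at the pole.
\<close>

definition damped_coeff :: "real \<Rightarrow> complex \<Rightarrow> nat \<Rightarrow> complex" where
  "damped_coeff e s j = pochhammer s j * hsum e (s + of_nat j) 1
     - (-1) ^ j * Gamma (1 - s) * of_real e powr (s + of_nat j - 1)"

lemma powr_eps_tendsto_0:
  assumes "Re s > 0"
  shows "(\<lambda>i. of_real (eps i) powr s) \<longlonglongrightarrow> (0 :: complex)"
proof (rule tendsto_norm_zero_cancel)
  have "(\<lambda>i. eps i powr Re s) \<longlonglongrightarrow> 0 powr Re s"
    by (rule tendsto_powr2[OF eps_tendsto_0]) (use assms eps_pos in \<open>auto intro!: always_eventually less_imp_le\<close>)
  thus "(\<lambda>i. norm (complex_of_real (eps i) powr s)) \<longlonglongrightarrow> 0"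
    using assms eps_pos by (simp add: norm_powr_real_powr less_imp_le)
qed

lemma hsum_eps_tendsto:
  assumes s: "Re s > 1"
  shows "(\<lambda>i. hsum (eps i) s 1) \<longlonglongrightarrow> zeta s"
  unfolding zeta_eq_hsum[OF s] hsum_def
proof (rule LIMSEQ_suminf_dominated)
  show "summable (\<lambda>n. norm (kern 0 s (real n + 1)))"
    by (rule summable_norm_kern) (use s in \<open>auto simp: damp_ok_def\<close>)
  show "norm (kern (eps i) s (real n + 1)) \<le> norm (kern 0 s (real n + 1))" for n i
    using eps_pos[of i] by (auto simp: norm_kern mult_le_cancel_left1)
  show "(\<lambda>i. kern (eps i) s (real n + 1)) \<longlonglongrightarrow> kern 0 s (real n + 1)" for n
    unfolding kern_def by (intro tendsto_intros eps_tendsto_0)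
qed

lemma damped_coeff_tendsto_Re_gt_1:
  assumes s: "Re s > 1"
  shows "(\<lambda>i. damped_coeff (eps i) s 0) \<longlonglongrightarrow> zeta s"
proof -
  have "(\<lambda>i. hsum (eps i) s 1 - Gamma (1 - s) * of_real (eps i) powr (s - 1)) \<longlonglongrightarrow> zeta s - Gamma (1 - s) * 0"
    by (intro tendsto_intros hsum_eps_tendsto powr_eps_tendsto_0) (use s in auto)
  thus ?thesis by (simp add: damped_coeff_def)
qed

text \<open>With z = 1 - s - j, combine Gamma(z) (z)_j = Gamma(1 - s) and (z)_j = (-1)^j (s)_j. The
  assumption keeps z away from the poles of Gamma.\<close>

lemma damped_coeff_shift:
  assumes "\<And>m. s + of_nat j \<noteq> of_nat (Suc m)"
  shows "damped_coeff e s j = pochhammer s j * damped_coeff e (s + of_nat j) 0"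
proof -
  define z where "z = 1 - s - of_nat j"
  have z: "z \<notin> \<int>\<^sub>\<le>\<^sub>0"
  proof
    assume "z \<in> \<int>\<^sub>\<le>\<^sub>0"
    then obtain n where "z = - of_nat n" by (auto elim: nonpos_Ints_cases')
    hence "s + of_nat j = of_nat (Suc n)" by (simp add: z_def algebra_simps)
    thus False using assms by blast
  qed
  have "pochhammer z j = (-1) ^ j * pochhammer s j"
    using pochhammer_minus[of "s + of_nat j - 1" j] by (simp add: z_def algebra_simps)
  moreover have "Gamma z * pochhammer z j = Gamma (1 - s)"
    using pochhammer_Gamma[OF z, of j] z by (simp add: z_def Gamma_eq_zero_iff)
  ultimately have "(-1) ^ j * Gamma (1 - s) = ((-1) ^ j * (-1) ^ j) * (pochhammer s j * Gamma z)"
    by (simp only: mult_ac)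
  also have "(-1 :: complex) ^ j * (-1) ^ j = 1"
    by (simp flip: power_mult_distrib)
  finally have "(-1) ^ j * Gamma (1 - s) = pochhammer s j * Gamma z" by simp
  thus ?thesis by (simp add: damped_coeff_def z_def algebra_simps)
qed

text \<open>Reduces index j at s to index 0 at s + j. If s + j is a positive integer r + 1, then s =
  -m and (s)_j = 0 removes the sum; the rest, -(-1)^j m! e^r, has a nonzero limit only for r = 0,
  that is, j = m + 1.\<close>

lemma damped_coeff_tendsto:
  assumes s: "\<And>m. s \<noteq> of_nat (Suc m)"
    and lim: "(\<And>m. s + of_nat j \<noteq> of_nat (Suc m)) \<Longrightarrow> (\<lambda>i. damped_coeff (eps i) (s + of_nat j) 0) \<longlonglongrightarrow> zeta (s + of_nat j)"
  shows "(\<lambda>i. damped_coeff (eps i) s j) \<longlonglongrightarrow> pochhammer_zeta s j"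
proof (cases "\<exists>r. s + of_nat j = of_nat (Suc r)")
  case False
  hence *: "s + of_nat j \<noteq> of_nat (Suc m)" for m by blast
  have "(\<lambda>i. pochhammer s j * damped_coeff (eps i) (s + of_nat j) 0) \<longlonglongrightarrow> pochhammer s j * zeta (s + of_nat j)"
    by (intro tendsto_intros lim *)
  also have "pochhammer s j * zeta (s + of_nat j) = pochhammer_zeta s j"
    using *[of 0] by (auto simp: pochhammer_zeta_def add_eq_0_iff2)
  finally show ?thesis by (simp add: damped_coeff_shift[OF *])
next
  case True
  then obtain r where r: "s + of_nat j = of_nat (Suc r)" by blast
  have rj: "Suc r \<le> j"
  proof (rule ccontr)
    assume "\<not> Suc r \<le> j"
    hence "s = of_nat (Suc (r - j))" using r by (simp add: of_nat_diff algebra_simps)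
    thus False using s by blast
  qed
  define m where "m = j - Suc r"
  have j: "j = m + Suc r" using rj by (simp add: m_def)
  have sm: "s = - of_nat m" using r unfolding j by (simp add: eq_neg_iff_add_eq_0)
  have p0: "pochhammer s j = 0"
    unfolding sm j by (rule pochhammer_of_nat_eq_0_lemma) simp
  have G: "Gamma (1 - s) = fact m"
    using Gamma_fact[of m, where 'a=complex] by (simp add: sm)
  have d: "damped_coeff (eps i) s j = - ((-1) ^ j * fact m * of_real (eps i) ^ r)" for i
  proof -
    have "s + of_nat j - 1 = of_nat r" using r by simp
    thus ?thesis using eps_pos[of i] by (simp add: damped_coeff_def p0 G powr_nat)
  qed
  have "(\<lambda>i. - ((-1) ^ j * fact m * complex_of_real (eps i) ^ r)) \<longlonglongrightarrow> - ((-1) ^ j * fact m * of_real 0 ^ r)"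
    by (intro tendsto_intros eps_tendsto_0)
  \<comment> \<open>Here \<open>0 ^ 0 = 1\<close> matters: r = 0 yields -(-1)^(m+1) m! = (-1)^m
    m!.\<close>
  also have "- ((-1) ^ j * fact m * complex_of_real 0 ^ r) = pochhammer_zeta s j"
  proof (cases "r = 0")
    case True
    thus ?thesis by (auto simp: pochhammer_zeta_def sm j)
  next
    case False
    thus ?thesis using p0 by (auto simp: pochhammer_zeta_def sm j)
  qed
  finally show ?thesis by (simp add: d)
qed

section \<open>Growth of the coefficients in j, uniformly in the damping\<close>

text \<open>All factors after the first exceed 1. This lets a constant, the Gamma term of
  \<open>damped_coeff\<close>, be absorbed into a multiple of (\<alpha>)_j.\<close>

lemma pochhammer_real_lower_bound:
  fixes \<alpha> :: real
  assumes "\<alpha> > 0"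
  shows "min 1 \<alpha> \<le> pochhammer \<alpha> j"
proof (cases j)
  case (Suc n)
  have "pochhammer (\<alpha> + 1) n \<ge> 1"
    unfolding pochhammer_prod by (rule prod_ge_1) (use assms in auto)
  hence "\<alpha> * 1 \<le> \<alpha> * pochhammer (\<alpha> + 1) n"
    using assms by (intro mult_left_mono) auto
  thus ?thesis by (simp add: Suc pochhammer_rec min_le_iff_disj)
qed auto

text \<open>The quotient |(s)_j| / (\<alpha>)_j does not increase once |s + j| <= \<alpha> + j,
  which holds for large j because Re s < \<alpha>.\<close>

lemma norm_pochhammer_le_real:
  fixes s :: complex
  assumes \<alpha>: "\<alpha> > 0" "Re s < \<alpha>"
  shows "\<exists>C\<ge>0. \<forall>j. norm (pochhammer s j) \<le> C * pochhammer \<alpha> j"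
proof -
  define r where "r j = norm (pochhammer s j) / pochhammer \<alpha> j" for j
  have pos: "pochhammer \<alpha> j > 0" for j using \<alpha> by (intro pochhammer_pos)
  \<comment> \<open>Squaring turns |s + j| <= \<alpha> + j into (Im s)^2 <= (\<alpha> - Re s)
    (\<alpha> + Re s + 2 j); the threshold guarantees this for j >= I.\<close>
  obtain I where I: "(Im s)\<^sup>2 / (\<alpha> - Re s) + \<bar>\<alpha> + Re s\<bar> < real I"
    using reals_Archimedean2 by blast
  have step: "r (Suc j) \<le> r j" if j: "j \<ge> I" for j
  proof -
    have "(Im s)\<^sup>2 / (\<alpha> - Re s) \<le> \<alpha> + Re s + 2 * real j"
      using I j by linarith
    hence "(Im s)\<^sup>2 \<le> (\<alpha> + Re s + 2 * real j) * (\<alpha> - Re s)"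
      using \<alpha> by (simp add: pos_divide_le_eq)
    hence "(norm (s + of_nat j))\<^sup>2 \<le> (\<alpha> + real j)\<^sup>2"
      unfolding cmod_power2 by (simp add: algebra_simps power2_eq_square)
    hence "norm (s + of_nat j) \<le> \<alpha> + real j"
      by (rule power2_le_imp_le) (use \<alpha> in auto)
    hence "norm (s + of_nat j) / (\<alpha> + real j) \<le> 1"
      using \<alpha> by (simp add: divide_le_eq)
    hence "r j * (norm (s + of_nat j) / (\<alpha> + real j)) \<le> r j * 1"
      by (rule mult_left_mono) (use pos[of j] in \<open>simp add: r_def\<close>)
    moreover have "r (Suc j) = r j * (norm (s + of_nat j) / (\<alpha> + real j))"
      unfolding r_def pochhammer_Suc norm_mult by simp
    ultimately show ?thesis by simp
  qed
  define C where "C = (\<Sum>j\<le>I. r j)"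
  have r0: "r j \<ge> 0" for j using pos[of j] by (simp add: r_def)
  have small: "r j \<le> C" if "j \<le> I" for j
    unfolding C_def by (rule member_le_sum) (use that r0 in auto)
  have rC: "r j \<le> C" for j
  proof (cases "j \<le> I")
    case False
    hence "I \<le> j" by simp
    thus ?thesis
      by (induction j rule: dec_induct) (use small step in \<open>auto intro: order_trans\<close>)
  qed (rule small)
  have "norm (pochhammer s j) \<le> C * pochhammer \<alpha> j" for j
    using rC[of j] pos[of j] by (simp add: r_def pos_divide_le_eq)
  moreover have "C \<ge> 0" unfolding C_def by (intro sum_nonneg r0)
  ultimately show ?thesis by blast
qed

lemma norm_damped_coeff_le:
  assumes e: "0 < e" "e \<le> 1" and j: "Re s + real j \<ge> 2"
  shows "norm (damped_coeff e s j) \<le> norm (pochhammer s j) * zeta2_bound + norm (Gamma (1 - s))"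
proof -
  have "norm (complex_of_real e powr (s + of_nat j - 1)) = e powr (Re s + real j - 1)"
    using e by (simp add: norm_powr_real_powr)
  also have "\<dots> \<le> 1" using e j by (intro powr_le1) auto
  finally have 1: "norm (complex_of_real e powr (s + of_nat j - 1)) \<le> 1" .
  have "norm (damped_coeff e s j) \<le> norm (pochhammer s j * hsum e (s + of_nat j) 1)
     + norm ((-1) ^ j * Gamma (1 - s) * of_real e powr (s + of_nat j - 1))"
    unfolding damped_coeff_def by (rule norm_triangle_ineq4)
  also have "\<dots> \<le> norm (pochhammer s j) * zeta2_bound + norm (Gamma (1 - s)) * 1"
    unfolding norm_mult using 1 e j
    by (intro add_mono mult_mono norm_hsum_le_zeta2_bound) (auto simp: norm_power)
  finally show ?thesis by simp
qed

text \<open>Large j are covered by \<open>norm_damped_coeff_le\<close>; for the finitely many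
  others, convergence in i implies boundedness. The start j1 permits j1 = 1, while the limit at j =
  0 is still to be found.\<close>

lemma damped_coeff_dominated:
  assumes \<alpha>: "\<alpha> > 0" "Re s < \<alpha>"
    and conv: "\<And>j. j \<ge> j1 \<Longrightarrow> convergent (\<lambda>i. damped_coeff (eps i) s j)"
  shows "\<exists>C\<ge>0. \<forall>i. \<forall>j\<ge>j1. norm (damped_coeff (eps i) s j) \<le> C * pochhammer \<alpha> j"
proof -
  have pos: "pochhammer \<alpha> j > 0" for j using \<alpha> by (intro pochhammer_pos)
  obtain C1 where C1: "C1 \<ge> 0" "\<And>j. norm (pochhammer s j) \<le> C1 * pochhammer \<alpha> j"
    using norm_pochhammer_le_real[OF \<alpha>] by blast
  obtain J where J: "2 - Re s < real J" using reals_Archimedean2 by blast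
  define C2 where "C2 = C1 * zeta2_bound + norm (Gamma (1 - s)) / min 1 \<alpha>"
  have C2: "C2 \<ge> 0" using C1(1) zeta2_bound_nonneg \<alpha> by (simp add: C2_def)
  have big: "norm (damped_coeff (eps i) s j) \<le> C2 * pochhammer \<alpha> j" if "j \<ge> J" for i j
  proof -
    have "norm (damped_coeff (eps i) s j) \<le> norm (pochhammer s j) * zeta2_bound + norm (Gamma (1 - s))"
      by (rule norm_damped_coeff_le) (use eps_pos eps_le_1 J that in auto)
    also have "\<dots> \<le> (C1 * pochhammer \<alpha> j) * zeta2_bound + norm (Gamma (1 - s)) * (pochhammer \<alpha> j / min 1 \<alpha>)"
    proof (intro add_mono mult_right_mono C1 zeta2_bound_nonneg)
      have "1 \<le> pochhammer \<alpha> j / min 1 \<alpha>"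
        using pochhammer_real_lower_bound[OF \<alpha>(1), of j] \<alpha> by (subst le_divide_eq) auto
      from mult_left_mono[OF this, of "norm (Gamma (1 - s))"]
      show "norm (Gamma (1 - s)) \<le> norm (Gamma (1 - s)) * (pochhammer \<alpha> j / min 1 \<alpha>)" by simp
    qed
    also have "\<dots> = C2 * pochhammer \<alpha> j" by (simp add: C2_def algebra_simps)
    finally show ?thesis .
  qed
  have "\<exists>B\<ge>0. \<forall>i. norm (damped_coeff (eps i) s j) \<le> B" if "j \<ge> j1" for j
  proof -
    have "Bseq (\<lambda>i. damped_coeff (eps i) s j)"
      by (rule convergent_imp_Bseq[OF conv[OF that]])
    thus ?thesis by (auto simp: Bseq_def intro: less_imp_le)
  qed
  then obtain B where B: "\<And>j. j \<ge> j1 \<Longrightarrow> B j \<ge> 0"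
      "\<And>j i. j \<ge> j1 \<Longrightarrow> norm (damped_coeff (eps i) s j) \<le> B j"
    by metis
  define C3 where "C3 = (\<Sum>j\<in>{j1..<J}. B j / pochhammer \<alpha> j)"
  have B0: "B j / pochhammer \<alpha> j \<ge> 0" if "j \<ge> j1" for j
    using B(1)[OF that] pos[of j] by simp
  have C3: "C3 \<ge> 0" unfolding C3_def by (intro sum_nonneg B0) auto
  have "norm (damped_coeff (eps i) s j) \<le> (C2 + C3) * pochhammer \<alpha> j" if j: "j \<ge> j1" for i j
  proof (cases "j \<ge> J")
    case True
    have "C2 * pochhammer \<alpha> j \<le> (C2 + C3) * pochhammer \<alpha> j"
      using C3 pos[of j] by (intro mult_right_mono) auto
    thus ?thesis using big[OF True, of i] by linarith
  next
    case False
    have "B j / pochhammer \<alpha> j \<le> C3"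
      unfolding C3_def using B0 j False by (intro member_le_sum) auto
    hence "B j \<le> C3 * pochhammer \<alpha> j" using pos[of j] by (simp add: pos_divide_le_eq)
    also have "\<dots> \<le> (C2 + C3) * pochhammer \<alpha> j"
      using C2 pos[of j] by (intro mult_right_mono) auto
    finally show ?thesis using B(2)[OF j, of i] by linarith
  qed
  moreover have "C2 + C3 \<ge> 0" using C2 C3 by simp
  ultimately show ?thesis by blast
qed

section \<open>The midpoint expansion after subtraction of the Gamma term\<close>

text \<open>Under the integral the series is exp(-e x) exp(e x) = 1, and the interval has length 1.
  It serves to distribute the Gamma term over the midpoint expansion.\<close>

lemma moment_exp_sum:
  assumes e: "e \<ge> 0"
  shows "(\<lambda>j. (- of_real e) ^ j / fact j * moment e j) sums 1"
proof -
  let ?g = "\<lambda>j x. complex_of_real (exp (- (e * x)) * (- x) ^ j)"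
  let ?c = "\<lambda>j. (- complex_of_real e) ^ j / fact j"
  have "(\<lambda>j. LINT x:{-1/2<..<1/2}|lborel. ?c j * ?g j x) sums (LINT x:{-1/2<..<1/2::real}|lborel. 1)"
  proof (rule set_integral_sums_dominated)
    show "set_borel_measurable lborel {-1/2<..<1/2} (\<lambda>x. ?c j * ?g j x)" for j
      by (rule set_borel_measurable_of_borel) auto
    show "(\<lambda>j. ?c j * ?g j x) sums 1" for x
    proof -
      have "(\<lambda>j. of_real (exp (- (e * x)) * ((e * x) ^ j /\<^sub>R fact j))) sums (of_real (exp (- (e * x)) * exp (e * x)) :: complex)"
        by (intro sums_of_real sums_mult exp_converges)
      also have "exp (- (e * x)) * exp (e * x) = 1" by (simp flip: exp_add)
      also have "(\<lambda>j. complex_of_real (exp (- (e * x)) * ((e * x) ^ j /\<^sub>R fact j))) = (\<lambda>j. ?c j * ?g j x)"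
      proof
        fix j
        have "(- complex_of_real e) ^ j * of_real ((- x) ^ j) = of_real ((e * x) ^ j)"
          by (simp flip: of_real_minus of_real_power of_real_mult power_mult_distrib)
        thus "complex_of_real (exp (- (e * x)) * ((e * x) ^ j /\<^sub>R fact j)) = ?c j * ?g j x"
          by (simp add: field_simps)
      qed
      finally show ?thesis by simp
    qed
    show "(\<Sum>j<N. norm (?c j * ?g j x)) \<le> exp e * exp e" if x: "x \<in> {-1/2<..<1/2}" for x N
    proof -
      have "(\<Sum>j<N. norm (?c j * ?g j x)) \<le> (\<Sum>j<N. e ^ j /\<^sub>R fact j * exp e)"
      proof (rule sum_mono)
        fix j
        have "norm (?c j * ?g j x) = e ^ j /\<^sub>R fact j * norm (?g j x)"
          unfolding norm_mult[of "?c j"] using e by (simp add: norm_divide norm_power field_simps)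
        also have "norm (?g j x) \<le> exp e * (1/2) ^ j" by (rule norm_moment_integrand_le[OF x e])
        also have "exp e * (1/2) ^ j \<le> exp e" by (simp add: power_le_one)
        finally show "norm (?c j * ?g j x) \<le> e ^ j /\<^sub>R fact j * exp e"
          using e by (simp add: mult_left_mono)
      qed
      also have "\<dots> = (\<Sum>j<N. e ^ j /\<^sub>R fact j) * exp e" by (simp add: sum_distrib_right)
      also have "(\<Sum>j<N. e ^ j /\<^sub>R fact j) \<le> exp e"
        unfolding exp_def by (rule sum_le_suminf[OF summable_exp_generic]) (use e in auto)
      finally show ?thesis by simp
    qed
    show "set_integrable lborel {-1/2<..<1/2} (\<lambda>x::real. exp e * exp e)"
      by (rule set_integrable_const_interval)
  qed auto
  also have "(\<lambda>j. LINT x:{-1/2<..<1/2}|lborel. ?c j * ?g j x) = (\<lambda>j. ?c j * moment e j)"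
    unfolding moment_def by (subst set_integral_mult_right) auto
  also have "(LINT x:{-1/2<..<1/2::real}|lborel. 1) = (1 :: complex)"
    by (simp add: set_lebesgue_integral_def)
  finally show ?thesis .
qed

text \<open>\<open>midpoint_expansion\<close> minus Gamma(1 - s) e^(s-1) times
  \<open>moment_exp_sum\<close>; as e^(s+j-1) = e^(s-1) e^j, the terms combine to
  \<open>damped_coeff\<close>.\<close>

lemma damped_midpoint_expansion:
  assumes e: "e > 0"
  shows "(\<lambda>j. damped_coeff e s j / fact j * moment e j) sums
           (tail_integral e s - Gamma (1 - s) * of_real e powr (s - 1))"
proof -
  have "(\<lambda>j. pochhammer s j / fact j * hsum e (s + of_nat j) 1 * moment e j
          - Gamma (1 - s) * of_real e powr (s - 1) * ((- of_real e) ^ j / fact j * moment e j))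
        sums (tail_integral e s - Gamma (1 - s) * of_real e powr (s - 1) * 1)"
    by (intro sums_diff sums_mult midpoint_expansion moment_exp_sum) (use e in \<open>auto simp: damp_ok_def\<close>)
  also have "(\<lambda>j. pochhammer s j / fact j * hsum e (s + of_nat j) 1 * moment e j
          - Gamma (1 - s) * of_real e powr (s - 1) * ((- of_real e) ^ j / fact j * moment e j))
     = (\<lambda>j. damped_coeff e s j / fact j * moment e j)"
  proof
    fix j
    have "complex_of_real e powr (s + of_nat j - 1) = of_real e powr (s - 1) * of_real e ^ j"
      using e powr_add[of "complex_of_real e" "s - 1" "of_nat j"] by (simp add: powr_nat algebra_simps)
    thus "pochhammer s j / fact j * hsum e (s + of_nat j) 1 * moment e j
          - Gamma (1 - s) * of_real e powr (s - 1) * ((- of_real e) ^ j / fact j * moment e j)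
        = damped_coeff e s j / fact j * moment e j"
      by (simp add: damped_coeff_def power_minus[of "complex_of_real e"] field_simps)
  qed
  finally show ?thesis by simp
qed

text \<open>For e > 0 and Re s < 1 the Gamma term is the integral over the whole half line, so this
  is minus the integral of \<open>kern e s\<close> over (0, 1/2].\<close>

definition damped_tail :: "real \<Rightarrow> complex \<Rightarrow> complex" where
  "damped_tail e s = tail_integral e s - Gamma (1 - s) * of_real e powr (s - 1)"

lemma norm_damped_tail_bounded:
  assumes s: "Re s < 1"
  shows "\<exists>B. \<forall>e. 0 < e \<and> e \<le> 1 \<longrightarrow> norm (damped_tail e s) \<le> B"
proof (intro exI allI impI)
  fix e :: real assume e: "0 < e \<and> e \<le> 1"
  have U: "{0<..} = {0<..1/2} \<union> {1/2::real<..}" by auto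
  have i: "set_integrable lborel {0<..} (kern e s)"
    by (rule set_integrable_kern_Ioi) (use e s in auto)
  have i1: "set_integrable lborel {0<..1/2} (kern e s)" "set_integrable lborel {1/2<..} (kern e s)"
    by (rule set_integrable_subset[OF i]; force)+
  have j: "set_integrable lborel {0<..1/2} (kern 1 s)"
    by (rule set_integrable_subset[OF set_integrable_kern_Ioi[of 1 s]]) (use s in auto)
  have "(LINT t:{0<..}|lborel. kern e s t) = (LINT t:{0<..1/2}|lborel. kern e s t) + tail_integral e s"
    unfolding U tail_integral_def by (rule set_integral_Un[OF _ i1]) auto
  hence "damped_tail e s = - (LINT t:{0<..1/2}|lborel. kern e s t)"
    unfolding damped_tail_def using set_integral_kern_Ioi[of e s] e s by simp
  hence "norm (damped_tail e s) \<le> (LINT t:{0<..1/2}|lborel. norm (kern e s t))"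
    using set_integral_norm_bound[OF i1(1)] by simp
  also have "\<dots> \<le> (LINT t:{0<..1/2}|lborel. exp (1/2) * norm (kern 1 s t))"
  proof (intro set_integral_mono set_integrable_norm i1 set_integrable_mult_right j)
    fix t :: real assume t: "t \<in> {0<..1/2}"
    \<comment> \<open>The detour through exp(1/2 - t) >= 1 gives a multiple of
      \<open>kern 1 s\<close>, which does not depend on e.\<close>
    have "exp (- (e * t)) \<le> exp 0" unfolding exp_le_cancel_iff using t e by simp
    also have "\<dots> \<le> exp (1/2 - t)" unfolding exp_le_cancel_iff using t by simp
    also have "\<dots> = exp (1/2) * exp (- t)" by (simp flip: exp_add)
    finally have "t powr (- Re s) * exp (- (e * t)) \<le> t powr (- Re s) * (exp (1/2) * exp (- t))"
      by (intro mult_left_mono) auto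
    thus "norm (kern e s t) \<le> exp (1/2) * norm (kern 1 s t)"
      using t by (simp add: norm_kern mult_ac)
  qed
  finally show "norm (damped_tail e s) \<le> (LINT t:{0<..1/2}|lborel. exp (1/2) * norm (kern 1 s t))" .
qed

text \<open>The recurrence expresses the tail by a boundary term and e times the tail at s - 1,
  which is bounded since Re (s - 1) < 1. Only the boundary term survives.\<close>

lemma damped_tail_tendsto:
  assumes s: "Re s < 2" "s \<noteq> 1"
  shows "(\<lambda>i. damped_tail (eps i) s) \<longlonglongrightarrow> 2 powr (s - 1) / (s - 1)"
proof -
  have z: "1 - s \<notin> \<int>\<^sub>\<le>\<^sub>0"
  proof
    assume "1 - s \<in> \<int>\<^sub>\<le>\<^sub>0"
    then obtain n where n: "1 - s = - of_nat n" by (auto elim: nonpos_Ints_cases')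
    hence "Re (1 - s) = - real n" by simp
    hence "n = 0" using s by (cases n) auto
    thus False using n s by simp
  qed
  have rec: "damped_tail e s = (of_real e * damped_tail e (s - 1) - kern e (s - 1) (1/2)) / (1 - s)" if e: "e > 0" for e
  proof -
    have "(1 - s) * tail_integral e s = of_real e * tail_integral e (s - 1) - kern e (s - 1) (1/2)"
      by (rule tail_integral_recurrence) (use e in \<open>simp add: damp_ok_def\<close>)
    moreover have "Gamma (1 - (s - 1)) = (1 - s) * Gamma (1 - s)"
      using Gamma_plus1[OF z] by (simp add: algebra_simps)
    moreover have "complex_of_real e * of_real e powr (s - 1 - 1) = of_real e powr (s - 1)"
      using e powr_add[of "complex_of_real e" 1 "s - 2"] by simp
    ultimately have "(1 - s) * tail_integral e s - ((1 - s) * Gamma (1 - s)) * of_real e powr (s - 1) =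
        (of_real e * tail_integral e (s - 1) - kern e (s - 1) (1/2))
          - Gamma (1 - (s - 1)) * (of_real e * of_real e powr (s - 1 - 1))"
      by (simp only:)
    hence "(1 - s) * damped_tail e s = of_real e * damped_tail e (s - 1) - kern e (s - 1) (1/2)"
      unfolding damped_tail_def by (simp only: right_diff_distrib mult_ac) (simp add: algebra_simps)
    thus ?thesis using s by (simp add: field_simps)
  qed
  obtain B where B: "\<And>e. 0 < e \<Longrightarrow> e \<le> 1 \<Longrightarrow> norm (damped_tail e (s - 1)) \<le> B"
    using norm_damped_tail_bounded[of "s - 1"] s by auto
  have 0: "(\<lambda>i. of_real (eps i) * damped_tail (eps i) (s - 1)) \<longlonglongrightarrow> 0"
  proof (rule Lim_null_comparison)
    show "(\<lambda>i. eps i * B) \<longlonglongrightarrow> 0" using tendsto_mult_right[OF eps_tendsto_0, of B] by simp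
    show "eventually (\<lambda>i. norm (of_real (eps i) * damped_tail (eps i) (s - 1)) \<le> eps i * B) sequentially"
      using eps_pos eps_le_1 B by (auto simp: norm_mult less_imp_le intro!: always_eventually mult_mono)
  qed
  have "(\<lambda>i. (of_real (eps i) * damped_tail (eps i) (s - 1) - kern (eps i) (s - 1) (1/2)) / (1 - s))
          \<longlonglongrightarrow> (0 - kern 0 (s - 1) (1/2)) / (1 - s)"
    unfolding kern_def by (intro tendsto_intros 0 eps_tendsto_0) (use s in auto)
  also have "(0 - kern 0 (s - 1) (1/2)) / (1 - s) = 2 powr (s - 1) / (s - 1)"
  proof -
    have "(1/2 :: complex) powr (1 - s) = 2 powr (s - 1)"
      using Ln_inverse[of 2] by (simp add: powr_def inverse_eq_divide algebra_simps)
    thus ?thesis using s by (simp add: kern_def divide_simps) (simp add: algebra_simps)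
  qed
  finally show ?thesis by (simp add: rec eps_pos)
qed

text \<open>Descent by strips: in \<open>damped_midpoint_expansion\<close> the limits for j >= 1 are
  known by induction and that of the tail by \<open>damped_tail_tendsto\<close>, so the term j = 0
  is determined. \<open>zeta_midpoint_expansion\<close> is the same identity for the limits.\<close>

lemma damped_coeff_tendsto_zeta:
  assumes "\<And>m. s \<noteq> of_nat (Suc m)"
  shows "(\<lambda>i. damped_coeff (eps i) s 0) \<longlonglongrightarrow> zeta s"
proof -
  obtain k where "1 - Re s < real k" using reals_Archimedean2 by blast
  hence "Re s > 1 - real k" by simp
  thus ?thesis using assms
  proof (induction k arbitrary: s)
    case 0
    thus ?case by (intro damped_coeff_tendsto_Re_gt_1) simp
  next
    case (Suc k)
    show ?case
    proof (cases "Re s > 1")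
      case True
      thus ?thesis by (rule damped_coeff_tendsto_Re_gt_1)
    next
      case False
      have s1: "s \<noteq> 1" using Suc.prems(2)[of 0] by simp
      have lim: "(\<lambda>i. damped_coeff (eps i) s j) \<longlonglongrightarrow> pochhammer_zeta s j" if "j \<ge> 1" for j
      proof (rule damped_coeff_tendsto[OF Suc.prems(2)])
        assume *: "\<And>m. s + of_nat j \<noteq> of_nat (Suc m)"
        have "Re (s + of_nat j) > 1 - real k" using Suc.prems(1) that by simp
        thus "(\<lambda>i. damped_coeff (eps i) (s + of_nat j) 0) \<longlonglongrightarrow> zeta (s + of_nat j)"
          using * by (rule Suc.IH)
      qed
      \<comment> \<open>In this case Re s <= 1 < 2, and the factor 2^(-j) from the moments makes the
        growth of (2)_j / j! harmless.\<close>
      obtain C where C: "C \<ge> 0" "\<And>i j. j \<ge> 1 \<Longrightarrow> norm (damped_coeff (eps i) s j) \<le> C * pochhammer 2 j"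
        using damped_coeff_dominated[of 2 s 1] False lim by (auto simp: convergent_def)
      let ?t = "\<lambda>i j. damped_coeff (eps i) s (Suc j) / fact (Suc j) * moment (eps i) (Suc j)"
      let ?M = "\<lambda>j. C * pochhammer 2 (Suc j) / fact (Suc j) * (exp 1 * (1/2) ^ Suc j)"
      have "(\<lambda>i. \<Sum>j. ?t i j) \<longlonglongrightarrow> (\<Sum>j. pochhammer_zeta s (Suc j) / fact (Suc j) * moment 0 (Suc j))"
      proof (rule LIMSEQ_suminf_dominated)
        show "(\<lambda>i. ?t i j) \<longlonglongrightarrow> pochhammer_zeta s (Suc j) / fact (Suc j) * moment 0 (Suc j)" for j
          by (intro tendsto_intros lim continuous_moment)
             (auto simp del: fact_Suc intro: eps_pos eps_le_1 eps_tendsto_0 less_imp_le)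
        show "norm (?t i j) \<le> ?M j" for i j
        proof -
          have "norm (moment (eps i) (Suc j)) \<le> exp (eps i) * (1/2) ^ Suc j"
            by (rule norm_moment_le) (simp add: eps_pos less_imp_le)
          also have "\<dots> \<le> exp 1 * (1/2) ^ Suc j"
            by (intro mult_right_mono) (auto simp: eps_le_1)
          finally have "norm (moment (eps i) (Suc j)) \<le> exp 1 * (1/2) ^ Suc j" .
          thus ?thesis
            unfolding norm_mult norm_divide norm_fact
            using C by (intro mult_mono divide_right_mono) (auto simp: pochhammer_nonneg)
        qed
        have "summable (\<lambda>j. norm (pochhammer (2 :: complex) (Suc j) / fact (Suc j)) * (1/2) ^ Suc j)"
          by (subst summable_Suc_iff) (use pochhammer_power_series[of "1/2" 2] in simp)
        moreover have "norm (pochhammer (2 :: complex) j) = pochhammer 2 j" for j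
          using pochhammer_of_real[of 2 j, where 'a=complex] by (simp add: pochhammer_nonneg)
        ultimately have "summable (\<lambda>j. pochhammer (2 :: real) (Suc j) / fact (Suc j) * (1/2) ^ Suc j)"
          by (simp only: norm_divide norm_fact)
        hence "summable (\<lambda>j. C * exp 1 * (pochhammer (2 :: real) (Suc j) / fact (Suc j) * (1/2) ^ Suc j))"
          by (rule summable_mult)
        thus "summable ?M" by (simp add: mult_ac)
      qed
      hence "(\<lambda>i. damped_tail (eps i) s - (\<Sum>j. ?t i j)) \<longlonglongrightarrow> 
          2 powr (s - 1) / (s - 1) - (\<Sum>j. pochhammer_zeta s (Suc j) / fact (Suc j) * moment 0 (Suc j))"
        by (intro tendsto_diff damped_tail_tendsto) (use False s1 in auto)
      also have "2 powr (s - 1) / (s - 1) - (\<Sum>j. pochhammer_zeta s (Suc j) / fact (Suc j) * moment 0 (Suc j)) = zeta s"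
        by (rule zeta_midpoint_expansion[OF s1, symmetric])
      also have "(\<lambda>i. damped_tail (eps i) s - (\<Sum>j. ?t i j)) = (\<lambda>i. damped_coeff (eps i) s 0 * moment (eps i) 0)"
      proof
        fix i
        have "(\<lambda>j. damped_coeff (eps i) s j / fact j * moment (eps i) j) sums damped_tail (eps i) s"
          unfolding damped_tail_def by (rule damped_midpoint_expansion[OF eps_pos])
        hence "?t i sums (damped_tail (eps i) s - damped_coeff (eps i) s 0 / fact 0 * moment (eps i) 0)"
          by (subst sums_Suc_iff) simp
        thus "damped_tail (eps i) s - (\<Sum>j. ?t i j) = damped_coeff (eps i) s 0 * moment (eps i) 0"
          by (simp add: sums_iff)
      qed
      finally have prod: "(\<lambda>i. damped_coeff (eps i) s 0 * moment (eps i) 0) \<longlonglongrightarrow> zeta s" .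
      \<comment> \<open>The limit is known for the coefficient times its moment; the moment tends to
        1 and can be divided out.\<close>
      have m: "(\<lambda>i. moment (eps i) 0) \<longlonglongrightarrow> 1"
        using continuous_moment[of eps 0] by (auto simp: moment_0_0 eps_pos eps_le_1 eps_tendsto_0 less_imp_le)
      have "(\<lambda>i. damped_coeff (eps i) s 0 * moment (eps i) 0 / moment (eps i) 0) \<longlonglongrightarrow> zeta s / 1"
        by (intro tendsto_divide prod m) auto
      hence "(\<lambda>i. damped_coeff (eps i) s 0 * moment (eps i) 0 / moment (eps i) 0) \<longlonglongrightarrow> zeta s"
        by simp
      moreover have "eventually (\<lambda>i. moment (eps i) 0 \<noteq> 0) sequentially"
        by (rule tendsto_imp_eventually_ne[OF m]) simp
      hence "eventually (\<lambda>i. damped_coeff (eps i) s 0 * moment (eps i) 0 / moment (eps i) 0 = damped_coeff (eps i) s 0) sequentially"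
        by eventually_elim simp
      ultimately show ?thesis by (rule Lim_transform_eventually)
    qed
  qed
qed

section \<open>The regularized Hurwitz function\<close>

lemma pochhammer_sums_powr:
  fixes \<alpha> x :: real
  assumes "\<bar>x\<bar> < 1"
  shows "(\<lambda>j. pochhammer \<alpha> j / fact j * x ^ j) sums ((1 - x) powr (- \<alpha>))"
proof -
  have "(\<lambda>j. (- \<alpha> gchoose j) * (- x) ^ j) sums ((1 + (- x)) powr (- \<alpha>))"
    by (rule gen_binomial_real) (use assms in simp)
  also have "(\<lambda>j. (- \<alpha> gchoose j) * (- x) ^ j) = (\<lambda>j. pochhammer \<alpha> j / fact j * x ^ j)"
  proof
    fix j
    have "(- \<alpha> gchoose j) * (- x) ^ j = ((-1) ^ j * (-1) ^ j) * (pochhammer \<alpha> j / fact j * x ^ j)"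
      by (simp add: gbinomial_pochhammer power_minus[of x] mult_ac)
    also have "(-1 :: real) ^ j * (-1) ^ j = 1" by (simp flip: power_mult_distrib)
    finally show "(- \<alpha> gchoose j) * (- x) ^ j = pochhammer \<alpha> j / fact j * x ^ j" by simp
  qed
  finally show ?thesis by simp
qed

text \<open>For e > 0 and Re s < 1 the subtracted constant is the mean of \<open>hsum e s\<close>
  over the unit interval.\<close>

definition regularized_hsum :: "real \<Rightarrow> complex \<Rightarrow> real \<Rightarrow> complex" where
  "regularized_hsum e s y = hsum e s y - Gamma (1 - s) * of_real e powr (s - 1)"

lemma borel_measurable_regularized_hsum [measurable]: "regularized_hsum e s \<in> borel_measurable borel"
  unfolding regularized_hsum_def by measurable

lemma exp_times_exp_reflected: "exp (e * (1 - y)) * exp (e * (y - 1)) = (1 :: real)"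
  by (simp flip: exp_add add: algebra_simps)

text \<open>\<open>hsum_expansion\<close> around 1 minus the constant times the exponential series
  of \<open>exp (e * (y - 1))\<close>; the coefficients are then the convergent
  \<open>damped_coeff\<close>.\<close>

lemma regularized_hsum_expansion:
  assumes e: "e > 0" and y: "y \<in> {0<..<1}"
  shows "(\<lambda>j. damped_coeff e s j / fact j * of_real (1 - y) ^ j) sums
           (of_real (exp (e * (y - 1))) * regularized_hsum e s y)"
proof -
  let ?G = "Gamma (1 - s) * complex_of_real e powr (s - 1)"
  have ok: "damp_ok e s" using e by (simp add: damp_ok_def)
  have "(\<lambda>j. complex_of_real ((e * (y - 1)) ^ j /\<^sub>R fact j)) sums of_real (exp (e * (y - 1)))"
    by (intro sums_of_real exp_converges)
  hence "(\<lambda>j. pochhammer s j / fact j * of_real (- (y - 1)) ^ j * hsum e (s + of_nat j) 1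
            - ?G * complex_of_real ((e * (y - 1)) ^ j /\<^sub>R fact j))
         sums (of_real (exp (e * (y - 1))) * hsum e s (1 + (y - 1)) - ?G * of_real (exp (e * (y - 1))))"
    by (intro sums_diff sums_mult hsum_expansion ok) (use y in auto)
  also have "(\<lambda>j. pochhammer s j / fact j * of_real (- (y - 1)) ^ j * hsum e (s + of_nat j) 1
            - ?G * complex_of_real ((e * (y - 1)) ^ j /\<^sub>R fact j))
       = (\<lambda>j. damped_coeff e s j / fact j * of_real (1 - y) ^ j)"
  proof
    fix j
    have p: "complex_of_real e powr (s + of_nat j - 1) = of_real e powr (s - 1) * of_real e ^ j"
      using e powr_add[of "complex_of_real e" "s - 1" "of_nat j"] by (simp add: powr_nat algebra_simps)
    have q: "complex_of_real ((e * (y - 1)) ^ j) = (-1) ^ j * (of_real e ^ j * of_real (1 - y) ^ j)"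
    proof -
      have "e * (y - 1) = (-1) * (e * (1 - y))" by (simp add: algebra_simps)
      thus ?thesis by (simp only: power_mult_distrib of_real_mult of_real_power) simp
    qed
    show "pochhammer s j / fact j * of_real (- (y - 1)) ^ j * hsum e (s + of_nat j) 1
            - ?G * complex_of_real ((e * (y - 1)) ^ j /\<^sub>R fact j)
        = damped_coeff e s j / fact j * of_real (1 - y) ^ j"
      unfolding damped_coeff_def p scaleR_conv_of_real of_real_mult q
      by (simp add: field_simps)
  qed
  finally show ?thesis by (simp add: regularized_hsum_def algebra_simps)
qed

section \<open>The limit function for Re s < 1\<close>

definition zeta_series :: "complex \<Rightarrow> real \<Rightarrow> complex" where
  "zeta_series s x = (\<Sum>j. pochhammer_zeta s j / fact j * of_real x ^ j)"

locale left_half =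
  fixes s :: complex
  assumes Re_less_1: "Re s < 1"
begin

lemma not_pos_int: "s \<noteq> of_nat (Suc m)"
  using Re_less_1 by auto

lemma damped_coeff_LIMSEQ: "(\<lambda>i. damped_coeff (eps i) s j) \<longlonglongrightarrow> pochhammer_zeta s j"
  by (intro damped_coeff_tendsto damped_coeff_tendsto_zeta not_pos_int)

text \<open>The midpoint between max(0, Re s) and 1: positive, so that (\<alpha>)_j > 0; above Re s,
  to dominate the coefficients; below 1, so that x^(-\<alpha>) is integrable at 0.\<close>

definition \<alpha> :: real where "\<alpha> = (max 0 (Re s) + 1) / 2"

lemma \<alpha>: "0 < \<alpha>" "\<alpha> < 1" "Re s < \<alpha>"
  using Re_less_1 by (auto simp: \<alpha>_def max_def)

lemma ex_bound: "\<exists>C\<ge>0. \<forall>i j. norm (damped_coeff (eps i) s j) \<le> C * pochhammer \<alpha> j"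
  using damped_coeff_dominated[of \<alpha> s 0] \<alpha> damped_coeff_LIMSEQ by (auto simp: convergent_def)

definition C :: real where
  "C = (SOME C. C \<ge> 0 \<and> (\<forall>i j. norm (damped_coeff (eps i) s j) \<le> C * pochhammer \<alpha> j))"

lemma C_nonneg: "C \<ge> 0"
  and norm_damped_coeff_le_C: "norm (damped_coeff (eps i) s j) \<le> C * pochhammer \<alpha> j"
  using someI_ex[of "\<lambda>C. C \<ge> 0 \<and> (\<forall>i j. norm (damped_coeff (eps i) s j) \<le> C * pochhammer \<alpha> j)"]
    ex_bound unfolding C_def by blast+

lemma norm_pochhammer_zeta_le: "norm (pochhammer_zeta s j) \<le> C * pochhammer \<alpha> j"
  by (rule LIMSEQ_le_const2[OF tendsto_norm[OF damped_coeff_LIMSEQ]])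
     (use norm_damped_coeff_le_C in blast)

lemma C_sums:
  assumes "x \<in> {0<..<1}"
  shows "(\<lambda>j. C * pochhammer \<alpha> j / fact j * x ^ j) sums (C * (1 - x) powr (- \<alpha>))"
  using sums_mult[OF pochhammer_sums_powr[of x \<alpha>], of C] assms by (simp add: mult_ac)

lemma norm_term_le:
  assumes x: "x \<in> {0<..<1}" and c: "norm c \<le> C * pochhammer \<alpha> j"
  shows "norm (c / fact j * complex_of_real x ^ j) \<le> C * pochhammer \<alpha> j / fact j * x ^ j"
  unfolding norm_mult norm_divide norm_fact norm_power
  using x c by (auto intro!: mult_right_mono divide_right_mono)

lemma zeta_series_sums:
  assumes "x \<in> {0<..<1}"
  shows "(\<lambda>j. pochhammer_zeta s j / fact j * of_real x ^ j) sums zeta_series s x"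
  unfolding zeta_series_def
  by (intro summable_sums summable_comparison_test'[OF sums_summable[OF C_sums[OF assms]]]
        norm_term_le assms norm_pochhammer_zeta_le)

lemma sum_norm_term_le:
  assumes x: "x \<in> {0<..<1}" and c: "\<And>j. norm (c j) \<le> C * pochhammer \<alpha> j"
  shows "(\<Sum>j<N. norm (c j / fact j * complex_of_real x ^ j)) \<le> C * (1 - x) powr (- \<alpha>)"
proof -
  have "(\<Sum>j<N. norm (c j / fact j * complex_of_real x ^ j)) \<le> (\<Sum>j<N. C * pochhammer \<alpha> j / fact j * x ^ j)"
    by (intro sum_mono norm_term_le x c)
  also have "\<dots> \<le> (\<Sum>j. C * pochhammer \<alpha> j / fact j * x ^ j)"
    using C_sums[OF x] C_nonneg \<alpha> x by (intro sum_le_suminf) (auto simp: sums_iff pochhammer_nonneg)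
  finally show ?thesis using C_sums[OF x] by (simp add: sums_iff)
qed

lemma norm_series_le:
  assumes x: "x \<in> {0<..<1}" and c: "\<And>j. norm (c j) \<le> C * pochhammer \<alpha> j"
    and S: "(\<lambda>j. c j / fact j * complex_of_real x ^ j) sums S"
  shows "norm S \<le> C * (1 - x) powr (- \<alpha>)"
proof (rule LIMSEQ_le_const2[OF tendsto_norm[OF S[unfolded sums_def]]], intro exI allI impI)
  fix N
  show "norm (\<Sum>j<N. c j / fact j * complex_of_real x ^ j) \<le> C * (1 - x) powr (- \<alpha>)"
    by (rule order_trans[OF norm_sum sum_norm_term_le[OF x c]])
qed

lemma norm_zeta_series_le:
  "x \<in> {0<..<1} \<Longrightarrow> norm (zeta_series s x) \<le> C * (1 - x) powr (- \<alpha>)"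
  by (rule norm_series_le[OF _ norm_pochhammer_zeta_le zeta_series_sums])

text \<open>The majorants of the coefficients sum to C y^(-\<alpha>) by the binomial series, and e
  <= 1 bounds the cost of removing the exponential factor. The bound is integrable and independent
  of i.\<close>

lemma norm_regularized_hsum_le:
  assumes y: "y \<in> {0<..<1}"
  shows "norm (regularized_hsum (eps i) s y) \<le> exp 1 * C * y powr (- \<alpha>)"
proof -
  have "norm (of_real (exp (eps i * (y - 1))) * regularized_hsum (eps i) s y) \<le> C * (1 - (1 - y)) powr (- \<alpha>)"
    by (rule norm_series_le[OF _ norm_damped_coeff_le_C regularized_hsum_expansion[OF eps_pos y]]) (use y in auto)
  hence "exp (eps i * (1 - y)) * (exp (eps i * (y - 1)) * norm (regularized_hsum (eps i) s y))
       \<le> exp (eps i * (1 - y)) * (C * y powr (- \<alpha>))"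
    by (intro mult_left_mono) (auto simp: norm_mult)
  also have "exp (eps i * (1 - y)) * (exp (eps i * (y - 1)) * norm (regularized_hsum (eps i) s y))
      = norm (regularized_hsum (eps i) s y)"
    by (simp only: mult.assoc [symmetric] exp_times_exp_reflected mult_1)
  also have "exp (eps i * (1 - y)) * (C * y powr (- \<alpha>)) \<le> exp 1 * (C * y powr (- \<alpha>))"
  proof (intro mult_right_mono)
    have "eps i * (1 - y) \<le> 1 * 1" using y eps_pos[of i] eps_le_1[of i] by (intro mult_mono) auto
    thus "exp (eps i * (1 - y)) \<le> exp 1" by simp
  qed (use C_nonneg in auto)
  finally show ?thesis by (simp add: mult_ac)
qed

lemma regularized_hsum_tendsto:
  assumes y: "y \<in> {0<..<1}"
  shows "(\<lambda>i. regularized_hsum (eps i) s y) \<longlonglongrightarrow> zeta_series s (1 - y)"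
proof -
  have y': "1 - y \<in> {0<..<1}" using y by auto
  have "(\<lambda>i. \<Sum>j. damped_coeff (eps i) s j / fact j * of_real (1 - y) ^ j) \<longlonglongrightarrow> zeta_series s (1 - y)"
    unfolding zeta_series_def
  proof (rule LIMSEQ_suminf_dominated)
    show "(\<lambda>i. damped_coeff (eps i) s j / fact j * of_real (1 - y) ^ j) \<longlonglongrightarrow>
            pochhammer_zeta s j / fact j * of_real (1 - y) ^ j" for j
      by (intro tendsto_intros damped_coeff_LIMSEQ) auto
  qed (rule norm_term_le[OF y' norm_damped_coeff_le_C] sums_summable[OF C_sums[OF y']])+
  moreover have "(\<Sum>j. damped_coeff (eps i) s j / fact j * of_real (1 - y) ^ j)
     = of_real (exp (eps i * (y - 1))) * regularized_hsum (eps i) s y" for i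
    using regularized_hsum_expansion[OF eps_pos y] by (rule sums_unique[symmetric])
  moreover have "(\<lambda>i. complex_of_real (exp (eps i * (1 - y)))) \<longlonglongrightarrow> of_real (exp (0 * (1 - y)))"
    by (intro tendsto_intros eps_tendsto_0)
  ultimately have "(\<lambda>i. of_real (exp (eps i * (1 - y))) * (of_real (exp (eps i * (y - 1))) * regularized_hsum (eps i) s y))
        \<longlonglongrightarrow> of_real (exp (0 * (1 - y))) * zeta_series s (1 - y)"
    by (intro tendsto_mult) simp_all
  thus ?thesis
    by (simp only: mult.assoc [symmetric] of_real_mult [symmetric] exp_times_exp_reflected)
       (simp only: of_real_1 mult_1 mult_zero_left exp_zero)
qed

end

lemma set_integrable_powr_unit:
  fixes \<alpha> \<beta> :: real
  assumes "\<alpha> < 1" "\<beta> < 1"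
  shows "set_integrable lborel {0<..<1} (\<lambda>x. (1 - x) powr (- \<alpha>) * x powr (- \<beta>))"
proof -
  have "set_integrable lborel {0..1} (\<lambda>x. x powr (- \<beta>) * (1 - x) powr (- \<alpha>))"
    using integrable_Beta[of "1 - \<beta>" "1 - \<alpha>"] assms by simp
  hence "set_integrable lborel {0<..<1} (\<lambda>x. x powr (- \<beta>) * (1 - x) powr (- \<alpha>))"
    by (rule set_integrable_subset) auto
  thus ?thesis by (simp add: mult.commute)
qed

lemma set_integrable_powr_unit':
  fixes \<beta> :: real
  assumes "\<beta> < 1"
  shows "set_integrable lborel {0<..<1} (\<lambda>x. x powr (- \<beta>))"
proof -
  have "set_integrable lborel {0<..<1::real} (\<lambda>x. (1 - x) powr (- 0) * x powr (- \<beta>))"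
    by (rule set_integrable_powr_unit) (use assms in auto)
  also have "?this \<longleftrightarrow> ?thesis"
    by (rule set_integrable_cong) auto
  finally show ?thesis .
qed

section \<open>Integrals over the unit interval at fixed damping\<close>

context left_half
begin

text \<open>Only the summand n = 0 is singular at x = 0, where x^(-Re s) <= x^(-\<alpha>); the
  others have a summable majorant independent of x.\<close>

lemma kern_cells_bound:
  assumes e: "e > 0"
  shows "\<exists>K\<ge>0. \<forall>x\<in>{0<..<1}. \<forall>N. (\<Sum>n<N. norm (kern e s (real n + x))) \<le> K * x powr (- \<alpha>)"
proof -
  define c where "c = \<bar>Re s\<bar>"
  define M where "M n = exp e * ((real n + 1) powr c * exp (- (e * (real n + 1))))" for n
  have M: "summable M" unfolding M_def by (intro summable_mult summable_powr_exp e)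
  have M0: "M n \<ge> 0" for n by (simp add: M_def)
  have "(\<Sum>n<N. norm (kern e s (real n + x))) \<le> (1 + suminf M) * x powr (- \<alpha>)" if x: "x \<in> {0<..<1}" for x N
  proof -
    have x\<alpha>: "1 \<le> x powr (- \<alpha>)" "x powr (- Re s) \<le> x powr (- \<alpha>)"
      using x \<alpha> powr_mono'[of "- \<alpha>" 0 x] powr_mono'[of "- \<alpha>" "- Re s" x] by auto
    have le: "norm (kern e s (real n + x)) \<le> (if n = 0 then x powr (- \<alpha>) else 0) + M n" for n
    proof (cases "n = 0")
      case True
      have "x powr (- Re s) * exp (- (e * x)) \<le> x powr (- \<alpha>) * 1"
        using x x\<alpha> e by (intro mult_mono) auto
      thus ?thesis using True x M0[of n] by (simp add: norm_kern)
    next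
      case False
      have "(real n + x) powr (- Re s) \<le> (real n + x) powr c"
        using False x by (intro powr_mono) (auto simp: c_def)
      also have "\<dots> \<le> (real n + 1) powr c"
        using x by (intro powr_mono2) (auto simp: c_def)
      finally have "(real n + x) powr (- Re s) * exp (- (e * (real n + x))) \<le> (real n + 1) powr c * exp (- (e * real n))"
        using x e by (intro mult_mono) auto
      also have "exp (- (e * real n)) = exp e * exp (- (e * (real n + 1)))"
        by (simp flip: exp_add add: algebra_simps)
      finally show ?thesis using False x by (simp add: norm_kern M_def mult_ac)
    qed
    have "(\<Sum>n<N. norm (kern e s (real n + x))) \<le> (\<Sum>n<N. (if n = 0 then x powr (- \<alpha>) else 0) + M n)"
      by (intro sum_mono le)
    also have "\<dots> = (\<Sum>n<N. if n = 0 then x powr (- \<alpha>) else 0) + (\<Sum>n<N. M n)"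
      by (rule sum.distrib)
    also have "\<dots> \<le> x powr (- \<alpha>) + suminf M"
      using M M0 by (intro add_mono sum_le_suminf) (auto simp: sum.delta)
    also have "\<dots> \<le> x powr (- \<alpha>) + suminf M * x powr (- \<alpha>)"
      using x\<alpha> mult_left_mono[of 1 "x powr (- \<alpha>)" "suminf M"] suminf_nonneg[OF M M0] by simp
    finally show ?thesis by (simp add: algebra_simps)
  qed
  moreover have "1 + suminf M \<ge> 0" using suminf_nonneg[OF M M0] by simp
  ultimately show ?thesis by blast
qed

lemma kern_cells_sums:
  assumes "e > 0" "x > 0"
  shows "(\<lambda>n. kern e s (real n + x)) sums hsum e s x"
  unfolding hsum_def using assms
  by (intro summable_sums summable_norm_cancel[OF summable_norm_kern]) (auto simp: damp_ok_def)

text \<open>Unfolding the sum over n turns the integral over one period into the Gamma integral over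
  the half line.\<close>

lemma hsum_unit_integral:
  assumes e: "e > 0"
  shows "set_integrable lborel {0<..<1} (hsum e s)"
    and "(LINT x:{0<..<1}|lborel. hsum e s x) = Gamma (1 - s) * of_real e powr (s - 1)"
proof -
  obtain K where K: "\<And>x N. x \<in> {0<..<1} \<Longrightarrow> (\<Sum>n<N. norm (kern e s (real n + x))) \<le> K * x powr (- \<alpha>)"
    using kern_cells_bound[OF e] by blast
  have meas: "set_borel_measurable lborel {0<..<1} (\<lambda>x. kern e s (real n + x))" for n
    by (rule set_borel_measurable_of_borel) auto
  have int: "set_integrable lborel {0<..<1} (\<lambda>x. K * x powr (- \<alpha>))"
    by (intro set_integrable_mult_right set_integrable_powr_unit' \<alpha>)
  have sums: "(\<lambda>n. kern e s (real n + x)) sums hsum e s x" if "x \<in> {0<..<1}" for x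
    using that by (intro kern_cells_sums e) auto
  note * = set_integral_sums_dominated[OF _ meas sums K int]
  show "set_integrable lborel {0<..<1} (hsum e s)" by (rule *) auto
  have "(\<lambda>n. LINT x:{0<..<0+1}|lborel. kern e s (real n + x)) sums (LINT x:{0<..}|lborel. kern e s x)"
    by (rule set_integral_unit_cells[OF set_integrable_kern_Ioi[OF e Re_less_1]])
  moreover have "(\<lambda>n. LINT x:{0<..<1}|lborel. kern e s (real n + x)) sums (LINT x:{0<..<1}|lborel. hsum e s x)"
    by (rule *) auto
  ultimately have "(LINT x:{0<..<1}|lborel. hsum e s x) = (LINT x:{0<..}|lborel. kern e s x)"
    by (simp add: sums_iff)
  thus "(LINT x:{0<..<1}|lborel. hsum e s x) = Gamma (1 - s) * of_real e powr (s - 1)"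
    using set_integral_kern_Ioi[OF e Re_less_1] by simp
qed

lemma regularized_hsum_unit_integral:
  assumes e: "e > 0"
  shows "(LINT x:{0<..<1}|lborel. regularized_hsum e s x) = 0"
proof -
  have c: "set_integrable lborel {0<..<1} (\<lambda>x::real. Gamma (1 - s) * complex_of_real e powr (s - 1))"
    by (rule set_integrable_const_interval)
  show ?thesis
    unfolding regularized_hsum_def
    by (subst set_integral_diff(2)[OF hsum_unit_integral(1)[OF e] c])
       (simp add: hsum_unit_integral(2)[OF e], simp add: set_lebesgue_integral_def)
qed

text \<open>The limit of functions of mean zero under an integrable majorant; this is what makes the
  column k = 0 vanish.\<close>

lemma zeta_series_integral: "(LINT x:{0<..<1}|lborel. zeta_series s (1 - x)) = 0"
proof -
  have "(\<lambda>i. LINT x:{0<..<1}|lborel. regularized_hsum (eps i) s x) \<longlonglongrightarrow> (LINT x:{0<..<1}|lborel. zeta_series s (1 - x))"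
  proof (rule set_integral_LIMSEQ_dominated)
    show "set_integrable lborel {0<..<1} (\<lambda>x. exp 1 * C * x powr (- \<alpha>))"
      by (intro set_integrable_mult_right set_integrable_powr_unit' \<alpha>)
    show "set_borel_measurable lborel {0<..<1} (regularized_hsum (eps i) s)" for i
      by (rule set_borel_measurable_of_borel) auto
  qed (auto intro: regularized_hsum_tendsto norm_regularized_hsum_le)
  thus ?thesis
    by (simp add: regularized_hsum_unit_integral eps_pos LIMSEQ_const_iff)
qed

end

section \<open>Convolution on the unit interval\<close>

text \<open>Euler's beta integral with complex exponents; its value follows later from comparing the
  divergent terms of the damped identity.\<close>

definition beta_integral :: "complex \<Rightarrow> complex \<Rightarrow> complex" where
  "beta_integral a b = (LINT u:{0<..<1}|lborel. kern 0 a (1 - u) * kern 0 b u)"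

lemma set_integrable_beta_integrand:
  assumes "Re a < 1" "Re b < 1"
  shows "set_integrable lborel {0<..<1} (\<lambda>u. kern 0 a (1 - u) * kern 0 b u)"
proof (rule set_integrable_bound)
  show "set_integrable lborel {0<..<1} (\<lambda>x. (1 - x) powr (- Re a) * x powr (- Re b))"
    by (rule set_integrable_powr_unit) fact+
  show "set_borel_measurable lborel {0<..<1} (\<lambda>u. kern 0 a (1 - u) * kern 0 b u)"
    by (rule set_borel_measurable_of_borel) auto
qed (auto simp: norm_mult norm_kern)

lemma convolution_kern_scaled:
  assumes T: "T > 0" and u: "u \<in> {0<..<1}"
  shows "kern e a (T - T * u) * kern e b (T * u) =
           of_real T powr (- (a + b)) * of_real (exp (- (e * T))) * (kern 0 a (1 - u) * kern 0 b u)"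
proof -
  have 1: "complex_of_real (T - T * u) powr (- a) = of_real T powr (- a) * of_real (1 - u) powr (- a)"
  proof -
    have "T - T * u = T * (1 - u)" by (simp add: algebra_simps)
    thus ?thesis using T u by (simp only: of_real_mult) (rule powr_times_real, auto)
  qed
  have 2: "complex_of_real (T * u) powr (- b) = of_real T powr (- b) * of_real u powr (- b)"
    using T u by (simp only: of_real_mult) (rule powr_times_real, auto)
  have 3: "complex_of_real T powr (- (a + b)) = of_real T powr (- a) * of_real T powr (- b)"
    using powr_add[of "complex_of_real T" "- a" "- b"] by simp
  have "exp (- (e * (T - T * u))) * exp (- (e * (T * u))) = exp (- (e * T))"
    by (simp flip: exp_add add: algebra_simps)
  hence 4: "complex_of_real (exp (- (e * T))) = of_real (exp (- (e * (T - T * u)))) * of_real (exp (- (e * (T * u))))"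
    by (simp only: of_real_mult [symmetric])
  show ?thesis
    unfolding kern_def 1 2 3 4 by simp
qed

text \<open>Scaling t = T u: the two dampings combine to exp(-e T), and the powers together with the
  Jacobian give T^(1-a-b).\<close>

lemma convolution_kern:
  assumes a: "Re a < 1" and b: "Re b < 1" and T: "T > 0"
  shows "set_integrable lborel {0<..<T} (\<lambda>t. kern e a (T - t) * kern e b t)"
    and "(LINT t:{0<..<T}|lborel. kern e a (T - t) * kern e b t) = beta_integral a b * kern e (a + b - 1) T"
proof -
  let ?f = "\<lambda>t. indicat_real {0<..<T} t *\<^sub>R (kern e a (T - t) * kern e b t)"
  let ?c = "complex_of_real T powr (- (a + b)) * of_real (exp (- (e * T)))"
  have f: "?f (0 + T * u) = ?c * (indicat_real {0<..<1} u *\<^sub>R (kern 0 a (1 - u) * kern 0 b u))" for u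
  proof (cases "u \<in> {0<..<1}")
    case True
    hence "T * u \<in> {0<..<T}" using T by auto
    thus ?thesis using True convolution_kern_scaled[OF T True, of e a b] by simp
  next
    case False
    hence "T * u \<notin> {0<..<T}" using T by (auto simp: zero_less_mult_iff)
    thus ?thesis using False by simp
  qed
  have "integrable lborel (\<lambda>u. ?f (0 + T * u))"
    unfolding f using set_integrable_beta_integrand[OF a b]
    by (intro integrable_mult_right) (simp add: set_integrable_def)
  thus "set_integrable lborel {0<..<T} (\<lambda>t. kern e a (T - t) * kern e b t)"
    unfolding set_integrable_def using T by (subst (asm) lborel_integrable_real_affine_iff) auto
  have "(LINT t:{0<..<T}|lborel. kern e a (T - t) * kern e b t) = T *\<^sub>R (LINT u|lborel. ?f (0 + T * u))"
    unfolding set_lebesgue_integral_def using lborel_integral_real_affine[of T ?f 0] T by simp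
  also have "\<dots> = of_real T * (?c * beta_integral a b)"
    unfolding f beta_integral_def set_lebesgue_integral_def by (simp add: scaleR_conv_of_real)
  also have "of_real T * (?c * beta_integral a b) = beta_integral a b * kern e (a + b - 1) T"
  proof -
    have "- (a + b - 1) = 1 + (- (a + b))" by simp
    moreover have "complex_of_real T powr (1 + (- (a + b))) = of_real T * of_real T powr (- (a + b))"
      using powr_add[of "complex_of_real T" 1 "- (a + b)"] T by simp
    ultimately show ?thesis unfolding kern_def by (simp only: mult_ac)
  qed
  finally show "(LINT t:{0<..<T}|lborel. kern e a (T - t) * kern e b t) = beta_integral a b * kern e (a + b - 1) T" .
qed

text \<open>The arguments i + (1 - x) and N - i + x add up to T = N + 1, so the summands are the
  pieces of the convolution at T on the N + 1 unit cells of (0, T).\<close>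

lemma convolution_kern_cells:
  assumes a: "Re a < 1" and b: "Re b < 1"
  shows "(LINT x:{0<..<1}|lborel. \<Sum>i\<le>N. kern e a (real i + (1 - x)) * kern e b (real (N - i) + x))
       = beta_integral a b * kern e (a + b - 1) (real N + 1)"
proof -
  define T where "T = real N + 1"
  \<comment> \<open>Extension by zero beyond T makes the decomposition of the half line into unit
    cells a finite sum.\<close>
  define f where "f t = indicat_real {0<..<T} t *\<^sub>R (kern e a (T - t) * kern e b t)" for t
  have T: "T > 0" by (simp add: T_def)
  note conv = convolution_kern[OF a b T, of e]
  have int: "integrable lborel f"
    using conv(1) unfolding set_integrable_def f_def .
  have pos: "set_integrable lborel {0<..} f"
    unfolding set_integrable_def using int
    by (rule back_subst[of "integrable lborel"]) (auto simp: f_def indicator_def)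
  have "(\<lambda>n. LINT x:{0<..<0+1}|lborel. f (real n + x)) sums (LINT x:{0<..}|lborel. f x)"
    by (rule set_integral_unit_cells[OF pos])
  also have "(LINT x:{0<..}|lborel. f x) = (LINT x:{0<..<T}|lborel. kern e a (T - x) * kern e b x)"
    unfolding set_lebesgue_integral_def f_def
    by (rule Bochner_Integration.integral_cong) (auto simp: indicator_def)
  also have "\<dots> = beta_integral a b * kern e (a + b - 1) T" by (rule conv(2))
  finally have s1: "(\<lambda>n. LINT x:{0<..<1}|lborel. f (real n + x)) sums (beta_integral a b * kern e (a + b - 1) T)"
    by simp
  have zero: "(LINT x:{0<..<1}|lborel. f (real n + x)) = 0" if "n \<notin> {..N}" for n
  proof -
    have "f (real n + x) = 0" if "x \<in> {0<..<1}" for x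
      using that \<open>n \<notin> {..N}\<close> by (auto simp: f_def indicator_def T_def)
    thus ?thesis by (subst set_lebesgue_integral_cong[where g="\<lambda>_. 0"]) auto
  qed
  have "(\<lambda>n. LINT x:{0<..<1}|lborel. f (real n + x)) sums (\<Sum>n\<le>N. LINT x:{0<..<1}|lborel. f (real n + x))"
    by (rule sums_finite) (use zero in auto)
  with s1 have fin: "(\<Sum>n\<le>N. LINT x:{0<..<1}|lborel. f (real n + x)) = beta_integral a b * kern e (a + b - 1) T"
    by (rule sums_unique2[symmetric])
  have fi: "set_integrable lborel {0<..<1} (\<lambda>x. f (real n + x))" for n
    by (subst set_integral_shift) (rule set_integrable_subset[OF pos], auto)
  have "(LINT x:{0<..<1}|lborel. \<Sum>i\<le>N. kern e a (real i + (1 - x)) * kern e b (real (N - i) + x))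
      = (LINT x:{0<..<1}|lborel. \<Sum>n\<le>N. f (real n + x))"
  proof (rule set_lebesgue_integral_cong, simp, intro allI impI)
    fix x :: real assume x: "x \<in> {0<..<1}"
    have "(\<Sum>n\<le>N. f (real n + x)) = (\<Sum>i\<le>N. f (real (N - i) + x))"
      by (rule sum.nat_diff_reindex[symmetric, where n="Suc N", simplified lessThan_Suc_atMost diff_Suc_Suc, simplified])
    also have "\<dots> = (\<Sum>i\<le>N. kern e a (real i + (1 - x)) * kern e b (real (N - i) + x))"
    proof (rule sum.cong)
      fix i assume i: "i \<in> {..N}"
      have "real (N - i) + x \<in> {0<..<T}" using x i by (auto simp: T_def)
      hence "f (real (N - i) + x) = kern e a (T - (real (N - i) + x)) * kern e b (real (N - i) + x)"
        by (simp add: f_def)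
      also have "T - (real (N - i) + x) = real i + (1 - x)"
        using i by (simp add: T_def of_nat_diff)
      finally show "f (real (N - i) + x) = kern e a (real i + (1 - x)) * kern e b (real (N - i) + x)" .
    qed auto
    finally show "(\<Sum>i\<le>N. kern e a (real i + (1 - x)) * kern e b (real (N - i) + x)) = (\<Sum>n\<le>N. f (real n + x))"
      by simp
  qed
  also have "\<dots> = (\<Sum>n\<le>N. LINT x:{0<..<1}|lborel. f (real n + x))"
    using fi unfolding set_lebesgue_integral_def set_integrable_def scaleR_sum_right
    by (subst Bochner_Integration.integral_sum) auto
  finally show ?thesis by (simp add: fin T_def)
qed

lemma set_integral_powers_unit:
  "(LINT x:{0<..<1}|lborel. complex_of_real x ^ j * complex_of_real (1 - x) ^ k) = fact j * fact k / fact (j + k + 1)"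
proof -
  have "((\<lambda>t. t powr (real (Suc j) - 1) * (1 - t) powr (real (Suc k) - 1)) has_integral Beta (real (Suc j)) (real (Suc k))) {0..1}"
    by (rule has_integral_Beta_real) auto
  hence h: "((\<lambda>t. t powr real j * (1 - t) powr real k) has_integral Beta (real (Suc j)) (real (Suc k))) {0<..<1}"
    by (simp add: has_integral_Icc_iff_Ioo)
  have i: "set_integrable lborel {0<..<1} (\<lambda>t::real. t powr real j * (1 - t) powr real k)"
    using set_integrable_powr_unit[of "- real k" "- real j"] by (simp add: mult.commute)
  have "(LINT x:{0<..<1}|lborel. complex_of_real x ^ j * complex_of_real (1 - x) ^ k)
      = (LINT x:{0<..<1}|lborel. complex_of_real (x powr real j * (1 - x) powr real k))"
    by (rule set_lebesgue_integral_cong) (auto simp: powr_realpow)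
  also have "\<dots> = of_real (LINT x:{0<..<1}|lborel. x powr real j * (1 - x) powr real k)"
    by (rule set_integral_complex_of_real)
  also have "(LINT x:{0<..<1}|lborel. x powr real j * (1 - x) powr real k) = Beta (real (Suc j)) (real (Suc k))"
    using set_borel_integral_eq_integral(2)[OF i] h by (simp add: has_integral_iff)
  also have "Beta (real (Suc j)) (real (Suc k)) = fact j * fact k / fact (j + k + 1)"
    using Gamma_fact[of j, where 'a=real] Gamma_fact[of k, where 'a=real] Gamma_fact[of "j + k + 1", where 'a=real]
    by (simp add: Beta_def add_ac)
  finally show ?thesis by simp
qed

locale left_half_pair = A: left_half a + B: left_half b for a b :: complex
begin

text \<open>Cauchy product of the two series: by \<open>convolution_kern_cells\<close> its N-th term
  integrates to the N-th term on the right, and the product of the two cell bounds is an integrable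
  majorant.\<close>

lemma hsum_convolution:
  assumes e: "e > 0"
  shows "set_integrable lborel {0<..<1} (\<lambda>x. hsum e a (1 - x) * hsum e b x)"
    and "(LINT x:{0<..<1}|lborel. hsum e a (1 - x) * hsum e b x) = beta_integral a b * hsum e (a + b - 1) 1"
proof -
  obtain K where K: "K \<ge> 0" "\<And>x N. x \<in> {0<..<1} \<Longrightarrow> (\<Sum>n<N. norm (kern e a (real n + x))) \<le> K * x powr (- A.\<alpha>)"
    using A.kern_cells_bound[OF e] by blast
  obtain L where L: "L \<ge> 0" "\<And>x N. x \<in> {0<..<1} \<Longrightarrow> (\<Sum>n<N. norm (kern e b (real n + x))) \<le> L * x powr (- B.\<alpha>)"
    using B.kern_cells_bound[OF e] by blast
  let ?h = "\<lambda>N x. \<Sum>i\<le>N. kern e a (real i + (1 - x)) * kern e b (real (N - i) + x)"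
  have ok: "damp_ok e s" for s using e by (simp add: damp_ok_def)
  have meas: "set_borel_measurable lborel {0<..<1} (?h N)" for N
    by (rule set_borel_measurable_of_borel) auto
  have int: "set_integrable lborel {0<..<1} (\<lambda>x. K * L * ((1 - x) powr (- A.\<alpha>) * x powr (- B.\<alpha>)))"
    by (intro set_integrable_mult_right set_integrable_powr_unit A.\<alpha> B.\<alpha>)
  have sums: "(\<lambda>N. ?h N x) sums (hsum e a (1 - x) * hsum e b x)" if x: "x \<in> {0<..<1}" for x
    unfolding hsum_def
    by (rule Cauchy_product_sums) (use x in \<open>auto intro!: summable_norm_kern ok\<close>)
  have bound: "(\<Sum>N<M. norm (?h N x)) \<le> K * L * ((1 - x) powr (- A.\<alpha>) * x powr (- B.\<alpha>))"
    if x: "x \<in> {0<..<1}" for x M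
  proof -
    let ?u = "\<lambda>i. norm (kern e a (real i + (1 - x)))" and ?v = "\<lambda>i. norm (kern e b (real i + x))"
    have su: "summable ?u" "summable ?v" using x by (auto intro!: summable_norm_kern ok)
    have cp: "(\<lambda>N. \<Sum>i\<le>N. ?u i * ?v (N - i)) sums (suminf ?u * suminf ?v)"
      by (rule Cauchy_product_sums) (use su in auto)
    have "(\<Sum>N<M. norm (?h N x)) \<le> (\<Sum>N<M. \<Sum>i\<le>N. ?u i * ?v (N - i))"
      by (intro sum_mono order_trans[OF norm_sum]) (simp add: norm_mult)
    also have "\<dots> \<le> suminf ?u * suminf ?v"
      using cp sum_le_suminf[OF sums_summable[OF cp], of "{..<M}"] by (simp add: sums_iff sum_nonneg)
    also have "\<dots> \<le> (K * (1 - x) powr (- A.\<alpha>)) * (L * x powr (- B.\<alpha>))"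
      using x su K L by (intro mult_mono suminf_le_const suminf_nonneg) auto
    finally show ?thesis by (simp add: mult_ac)
  qed
  note * = set_integral_sums_dominated[OF _ meas sums bound int]
  show "set_integrable lborel {0<..<1} (\<lambda>x. hsum e a (1 - x) * hsum e b x)" by (rule *) auto
  have "(\<lambda>N. LINT x:{0<..<1}|lborel. ?h N x) sums (LINT x:{0<..<1}|lborel. hsum e a (1 - x) * hsum e b x)"
    by (rule *) auto
  hence "(\<lambda>N. beta_integral a b * kern e (a + b - 1) (real N + 1)) sums (LINT x:{0<..<1}|lborel. hsum e a (1 - x) * hsum e b x)"
    by (simp only: convolution_kern_cells[OF A.Re_less_1 B.Re_less_1])
  moreover have "(\<lambda>N. beta_integral a b * kern e (a + b - 1) (real N + 1)) sums (beta_integral a b * hsum e (a + b - 1) 1)"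
    unfolding hsum_def
    by (intro sums_mult summable_sums summable_norm_cancel[OF summable_norm_kern] ok) auto
  ultimately show "(LINT x:{0<..<1}|lborel. hsum e a (1 - x) * hsum e b x) = beta_integral a b * hsum e (a + b - 1) 1"
    by (rule sums_unique2)
qed

text \<open>Each factor loses its own mean, p or q. The corrections -q p, -p q and +p q leave
  exactly -p q.\<close>

lemma regularized_convolution:
  assumes e: "e > 0"
  shows "(LINT x:{0<..<1}|lborel. regularized_hsum e a (1 - x) * regularized_hsum e b x) =
     beta_integral a b * hsum e (a + b - 1) 1 - Gamma (1 - a) * Gamma (1 - b) * of_real e powr (a + b - 2)"
proof -
  define p where "p = Gamma (1 - a) * complex_of_real e powr (a - 1)"
  define q where "q = Gamma (1 - b) * complex_of_real e powr (b - 1)"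
  have iF: "set_integrable lborel {0<..<1} (\<lambda>x. hsum e a (1 - x))"
    using A.hsum_unit_integral(1)[OF e] by (subst set_integral_reflect(1))
  have IF: "(LINT x:{0<..<1}|lborel. hsum e a (1 - x)) = p"
    using A.hsum_unit_integral(2)[OF e] by (subst set_integral_reflect(2)) (simp add: p_def)
  note iG = B.hsum_unit_integral(1)[OF e]
  have IG: "(LINT x:{0<..<1}|lborel. hsum e b x) = q"
    using B.hsum_unit_integral(2)[OF e] by (simp add: q_def)
  note iFG = hsum_convolution(1)[OF e]
  have ipq: "set_integrable lborel {0<..<1} (\<lambda>x::real. p * q)"
    by (rule set_integrable_const_interval)
  have const: "(LINT x:{0<..<1::real}|lborel. c) = c" for c :: complex
    by (simp add: set_lebesgue_integral_def)
  have "(LINT x:{0<..<1}|lborel. regularized_hsum e a (1 - x) * regularized_hsum e b x) =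
     (LINT x:{0<..<1}|lborel. (hsum e a (1 - x) * hsum e b x - q * hsum e a (1 - x)) - (p * hsum e b x - p * q))"
    by (simp add: regularized_hsum_def p_def q_def algebra_simps)
  also have "\<dots> = ((beta_integral a b * hsum e (a + b - 1) 1 - q * p) - (p * q - p * q))"
    using iF iG iFG ipq by (simp add: set_integral_diff hsum_convolution(2)[OF e] IF IG const)
  also have "\<dots> = beta_integral a b * hsum e (a + b - 1) 1 - Gamma (1 - a) * Gamma (1 - b) * of_real e powr (a + b - 2)"
    using powr_add[of "complex_of_real e" "a - 1" "b - 1"] e by (simp add: p_def q_def algebra_simps)
  finally show ?thesis .
qed

definition zeta_convolution :: complex where
  "zeta_convolution = (LINT x:{0<..<1}|lborel. zeta_series a x * zeta_series b (1 - x))"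

lemma majorant_integrable:
  "set_integrable lborel {0<..<1} (\<lambda>x. c * ((1 - x) powr (- A.\<alpha>) * x powr (- B.\<alpha>)))"
  by (intro set_integrable_mult_right set_integrable_powr_unit A.\<alpha> B.\<alpha>)

lemma regularized_convolution_tendsto:
  "(\<lambda>i. LINT x:{0<..<1}|lborel. regularized_hsum (eps i) a (1 - x) * regularized_hsum (eps i) b x) \<longlonglongrightarrow> zeta_convolution"
  unfolding zeta_convolution_def
proof (rule set_integral_LIMSEQ_dominated[OF _ _ _ _ majorant_integrable])
  show "set_borel_measurable lborel {0<..<1} (\<lambda>x. regularized_hsum (eps i) a (1 - x) * regularized_hsum (eps i) b x)" for i
    by (rule set_borel_measurable_of_borel) auto
  fix x :: real assume x: "x \<in> {0<..<1}"
  have x': "1 - x \<in> {0<..<1}" using x by auto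
  show "(\<lambda>i. regularized_hsum (eps i) a (1 - x) * regularized_hsum (eps i) b x) \<longlonglongrightarrow> zeta_series a x * zeta_series b (1 - x)"
    using tendsto_mult[OF A.regularized_hsum_tendsto[OF x'] B.regularized_hsum_tendsto[OF x]] by simp
  fix i
  have "norm (regularized_hsum (eps i) a (1 - x) * regularized_hsum (eps i) b x)
      \<le> (exp 1 * A.C * (1 - x) powr (- A.\<alpha>)) * (exp 1 * B.C * x powr (- B.\<alpha>))"
    unfolding norm_mult using A.norm_regularized_hsum_le[OF x'] B.norm_regularized_hsum_le[OF x] A.C_nonneg
    by (intro mult_mono) auto
  thus "norm (regularized_hsum (eps i) a (1 - x) * regularized_hsum (eps i) b x)
      \<le> (exp 1 * A.C * exp 1 * B.C) * ((1 - x) powr (- A.\<alpha>) * x powr (- B.\<alpha>))"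
    by (simp add: mult_ac)
qed auto

text \<open>
  One limit yields both facts. The damped identity has a main term of order \<open>e\<^sup>a\<^sup>+\<^sup>b\<^sup>-\<^sup>2\<close>, whose coefficient
  \<open>d\<close> must vanish, which is the complex beta integral; the bounded remainder then gives the convolution.
\<close>

lemma beta_integral_and_zeta_convolution_eq:
  "beta_integral a b = Beta (1 - a) (1 - b)" "zeta_convolution = Beta (1 - a) (1 - b) * zeta (a + b - 1)"
proof -
  define s where "s = a + b - 1"
  have s: "Re s < 1" using A.Re_less_1 B.Re_less_1 by (simp add: s_def)
  interpret S: left_half s by standard (rule s)
  define I where "I i = (LINT x:{0<..<1}|lborel. regularized_hsum (eps i) a (1 - x) * regularized_hsum (eps i) b x)" for i
  define d where "d = Gamma (1 - a) * Gamma (1 - b) - beta_integral a b * Gamma (1 - s)"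
  have D: "(\<lambda>i. damped_coeff (eps i) s 0) \<longlonglongrightarrow> zeta s"
    using S.damped_coeff_LIMSEQ[of 0] by (simp add: pochhammer_zeta_0)
  have I_lim: "I \<longlonglongrightarrow> zeta_convolution" using regularized_convolution_tendsto by (simp add: I_def [abs_def])
  have I: "I i = beta_integral a b * damped_coeff (eps i) s 0 - d * of_real (eps i) powr (s - 1)" for i
  proof -
    have *: "a + b - 2 = s - 1" by (simp add: s_def)
    show ?thesis
      unfolding I_def regularized_convolution[OF eps_pos] * s_def [symmetric]
      by (simp add: damped_coeff_def d_def algebra_simps)
  qed
  \<comment> \<open>Multiplication by e^(1-s), which tends to 0 since Re s < 1, turns the main term
    into the constant d and kills the convergent rest.\<close>
  have "(\<lambda>i. of_real (eps i) powr (1 - s) * (beta_integral a b * damped_coeff (eps i) s 0 - I i)) \<longlonglongrightarrow> 0 * (beta_integral a b * zeta s - zeta_convolution)"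
    by (intro tendsto_intros powr_eps_tendsto_0 D I_lim) (use s in auto)
  also have "(\<lambda>i. of_real (eps i) powr (1 - s) * (beta_integral a b * damped_coeff (eps i) s 0 - I i)) = (\<lambda>i. d)"
  proof
    fix i
    have "of_real (eps i) powr (1 - s) * of_real (eps i) powr (s - 1) = (1 :: complex)"
      using powr_add[of "complex_of_real (eps i)" "1 - s" "s - 1"] eps_pos[of i] by simp
    thus "of_real (eps i) powr (1 - s) * (beta_integral a b * damped_coeff (eps i) s 0 - I i) = d"
      unfolding I by (simp add: algebra_simps)
  qed
  finally have d: "d = 0" by (simp add: LIMSEQ_const_iff)
  have "Gamma (1 - s) \<noteq> 0"
  proof -
    have "1 - s \<notin> \<int>\<^sub>\<le>\<^sub>0" using s by (auto elim!: nonpos_Ints_cases' simp: complex_eq_iff)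
    thus ?thesis by (simp add: Gamma_eq_zero_iff)
  qed
  moreover have "1 - s = (1 - a) + (1 - b)" by (simp add: s_def)
  ultimately show 1: "beta_integral a b = Beta (1 - a) (1 - b)"
    using d by (simp add: d_def Beta_def field_simps)
  have "(\<lambda>i. beta_integral a b * damped_coeff (eps i) s 0) \<longlonglongrightarrow> beta_integral a b * zeta s"
    by (intro tendsto_intros D)
  moreover have "I = (\<lambda>i. beta_integral a b * damped_coeff (eps i) s 0)"
    using I by (auto simp: d)
  ultimately show "zeta_convolution = Beta (1 - a) (1 - b) * zeta (a + b - 1)"
    using I_lim LIMSEQ_unique by (auto simp: 1 s_def)
qed

section \<open>Termwise integration: rows, total and the column k = 0\<close>

text \<open>Only the second factor is expanded; x^j <= 1 leaves the integrable majorant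
  x^(-\<alpha>) belonging to b. The beta integral of x^j (1 - x)^k supplies the factorials.\<close>

lemma inner_sums:
  "(\<lambda>k. pochhammer_zeta a j * pochhammer_zeta b k / fact (j + k + 1)) sums
     (LINT x:{0<..<1}|lborel. pochhammer_zeta a j / fact j * of_real x ^ j * zeta_series b (1 - x))"
proof -
  let ?c = "\<lambda>k. pochhammer_zeta b k / fact k"
  let ?p = "pochhammer_zeta a j / fact j"
  let ?f = "\<lambda>k x. ?p * of_real x ^ j * (?c k * complex_of_real (1 - x) ^ k)"
  have "(\<lambda>k. LINT x:{0<..<1}|lborel. ?f k x) sums
     (LINT x:{0<..<1}|lborel. ?p * of_real x ^ j * zeta_series b (1 - x))"
  proof (rule set_integral_sums_dominated)
    show "set_borel_measurable lborel {0<..<1} (?f k)" for k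
      by (rule set_borel_measurable_of_borel) auto
    show "set_integrable lborel {0<..<1} (\<lambda>x. norm ?p * B.C * x powr (- B.\<alpha>))"
      by (intro set_integrable_mult_right set_integrable_powr_unit' B.\<alpha>)
    fix x :: real assume x: "x \<in> {0<..<1}"
    have x': "1 - x \<in> {0<..<1}" using x by auto
    show "(\<lambda>k. ?f k x) sums (?p * of_real x ^ j * zeta_series b (1 - x))"
      by (intro sums_mult B.zeta_series_sums x')
    fix N
    have "(\<Sum>k<N. norm (?f k x)) = norm (?p * of_real x ^ j) * (\<Sum>k<N. norm (?c k * complex_of_real (1 - x) ^ k))"
      by (simp only: norm_mult sum_distrib_left)
    also have "norm (?p * complex_of_real x ^ j) = norm ?p * x ^ j"
      unfolding norm_mult norm_power using x by simp
    also have "norm ?p * x ^ j * (\<Sum>k<N. norm (?c k * complex_of_real (1 - x) ^ k)) \<le> (norm ?p * 1) * (B.C * (1 - (1 - x)) powr (- B.\<alpha>))"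
      using x by (intro mult_mono B.sum_norm_term_le[OF x' B.norm_pochhammer_zeta_le] sum_nonneg)
        (auto simp: power_le_one)
    finally show "(\<Sum>k<N. norm (?f k x)) \<le> norm ?p * B.C * x powr (- B.\<alpha>)" by simp
  qed auto
  also have "(\<lambda>k. LINT x:{0<..<1}|lborel. ?f k x) = (\<lambda>k. pochhammer_zeta a j * pochhammer_zeta b k / fact (j + k + 1))"
  proof
    fix k
    have "(LINT x:{0<..<1}|lborel. ?f k x) = (LINT x:{0<..<1}|lborel. ?p * ?c k * (complex_of_real x ^ j * complex_of_real (1 - x) ^ k))"
      by (simp add: mult_ac)
    also have "\<dots> = ?p * ?c k * (fact j * fact k / fact (j + k + 1))"
      by (simp only: set_integral_mult_right set_integral_powers_unit)
    also have "\<dots> = pochhammer_zeta a j * pochhammer_zeta b k / fact (j + k + 1)"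
      by simp
    finally show "(LINT x:{0<..<1}|lborel. ?f k x) = pochhammer_zeta a j * pochhammer_zeta b k / fact (j + k + 1)" .
  qed
  finally show ?thesis .
qed

lemma outer_sums:
  "(\<lambda>j. LINT x:{0<..<1}|lborel. pochhammer_zeta a j / fact j * of_real x ^ j * zeta_series b (1 - x)) sums zeta_convolution"
  unfolding zeta_convolution_def
proof (rule set_integral_sums_dominated[OF _ _ _ _ majorant_integrable])
  have m: "zeta_series b \<in> borel_measurable borel" 
    unfolding zeta_series_def by measurable
  show "set_borel_measurable lborel {0<..<1} (\<lambda>x. pochhammer_zeta a j / fact j * of_real x ^ j * zeta_series b (1 - x))" for j
    by (rule set_borel_measurable_of_borel) (use m in auto)
  fix x :: real assume x: "x \<in> {0<..<1}"
  have x': "1 - x \<in> {0<..<1}" using x by auto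
  show "(\<lambda>j. pochhammer_zeta a j / fact j * of_real x ^ j * zeta_series b (1 - x)) sums (zeta_series a x * zeta_series b (1 - x))"
    by (intro sums_mult2 A.zeta_series_sums x)
  fix N
  have "(\<Sum>j<N. norm (pochhammer_zeta a j / fact j * of_real x ^ j * zeta_series b (1 - x)))
     = (\<Sum>j<N. norm (pochhammer_zeta a j / fact j * complex_of_real x ^ j)) * norm (zeta_series b (1 - x))"
    by (simp only: norm_mult sum_distrib_right)
  also have "\<dots> \<le> (A.C * (1 - x) powr (- A.\<alpha>)) * (B.C * (1 - (1 - x)) powr (- B.\<alpha>))"
    using A.C_nonneg
    by (intro mult_mono A.sum_norm_term_le[OF x A.norm_pochhammer_zeta_le] B.norm_zeta_series_le[OF x']) auto
  finally show "(\<Sum>j<N. norm (pochhammer_zeta a j / fact j * of_real x ^ j * zeta_series b (1 - x)))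
     \<le> A.C * B.C * ((1 - x) powr (- A.\<alpha>) * x powr (- B.\<alpha>))"
    by (simp add: mult_ac)
qed auto

text \<open>Termwise integration of \<open>zeta_series a\<close> produces the entries up to the
  constant \<open>pochhammer_zeta b 0\<close>, and the integral is 0.\<close>

lemma column_0_sums: "(\<lambda>j. pochhammer_zeta a j * pochhammer_zeta b 0 / fact (j + 0 + 1)) sums 0"
proof -
  let ?f = "\<lambda>j x. pochhammer_zeta a j / fact j * complex_of_real x ^ j"
  have "(\<lambda>j. LINT x:{0<..<1}|lborel. ?f j x) sums (LINT x:{0<..<1}|lborel. zeta_series a x)"
  proof (rule set_integral_sums_dominated)
    show "set_borel_measurable lborel {0<..<1} (?f j)" for j
      by (rule set_borel_measurable_of_borel) auto
    have "set_integrable lborel {0<..<1} (\<lambda>x. (1 - x) powr (- A.\<alpha>) * x powr (- 0))"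
      by (rule set_integrable_powr_unit) (use A.\<alpha> in auto)
    also have "?this \<longleftrightarrow> set_integrable lborel {0<..<1} (\<lambda>x. (1 - x) powr (- A.\<alpha>))"
      by (rule set_integrable_cong) auto
    finally show "set_integrable lborel {0<..<1} (\<lambda>x. A.C * (1 - x) powr (- A.\<alpha>))"
      by (rule set_integrable_mult_right)
    fix x :: real assume x: "x \<in> {0<..<1}"
    show "(\<lambda>j. ?f j x) sums zeta_series a x"
      by (rule A.zeta_series_sums[OF x])
    show "(\<Sum>j<N. norm (?f j x)) \<le> A.C * (1 - x) powr (- A.\<alpha>)" for N
      by (rule A.sum_norm_term_le[OF x A.norm_pochhammer_zeta_le])
  qed auto
  also have "(LINT x:{0<..<1}|lborel. zeta_series a x) = 0"
    using A.zeta_series_integral set_integral_reflect(2)[of "zeta_series a"] by simp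
  also have "(\<lambda>j. LINT x:{0<..<1}|lborel. ?f j x) = (\<lambda>j. pochhammer_zeta a j / fact (j + 1))"
  proof
    fix j
    have "(LINT x:{0<..<1}|lborel. ?f j x) = pochhammer_zeta a j / fact j * (fact j * fact 0 / fact (j + 0 + 1))"
      using set_integral_powers_unit[of j 0] by (simp only: set_integral_mult_right power_0 mult_1_right)
    thus "(LINT x:{0<..<1}|lborel. ?f j x) = pochhammer_zeta a j / fact (j + 1)" by simp
  qed
  finally have "(\<lambda>j. pochhammer_zeta a j / fact (j + 1)) sums 0" .
  from sums_mult2[OF this, of "pochhammer_zeta b 0"] show ?thesis by (simp add: mult_ac)
qed

end

theorem theorem2:
  fixes a b :: complex
  assumes "Re a < 1" and "Re b < 1"
  shows "(\<forall>j. summable (\<lambda>k. pochhammer_zeta a j * pochhammer_zeta b (Suc k)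
                              / fact (j + Suc k + 1))) \<and>
         (\<lambda>j. \<Sum>k. pochhammer_zeta a j * pochhammer_zeta b (Suc k) / fact (j + Suc k + 1))
           sums (Beta (1 - a) (1 - b) * zeta (a + b - 1))"
proof -
  interpret left_half_pair a b
    using assms by (simp add: left_half_pair_def left_half_def)
  let ?t = "\<lambda>j k. pochhammer_zeta a j * pochhammer_zeta b k / fact (j + k + 1)"
  let ?I = "\<lambda>j. LINT x:{0<..<1}|lborel. pochhammer_zeta a j / fact j * of_real x ^ j * zeta_series b (1 - x)"
  have row: "(\<lambda>k. ?t j (Suc k)) sums (?I j - ?t j 0)" for j
    using inner_sums[of j] by (subst sums_Suc_iff) simp
  \<comment> \<open>The rows start at k = 1; dropping the entries at k = 0 does not change the total
    because that column sums to 0.\<close>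
  have "(\<lambda>j. ?I j - ?t j 0) sums (zeta_convolution - 0)"
    by (intro sums_diff outer_sums column_0_sums)
  hence "(\<lambda>j. \<Sum>k. ?t j (Suc k)) sums zeta_convolution"
    using row by (simp add: sums_iff)
  thus ?thesis
    using row by (simp only: beta_integral_and_zeta_convolution_eq(2)) (auto intro: sums_summable)
qed

end
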